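(* Let $\triangle^\ell_{\mathrm{PS}}$ be a Powell--Sabin refinement of $\triangle^\ell$, and let $\mathbb S_2(\triangle^\ell_{\mathrm{PS}})$ be the linear span of the vertex functions $B_1,\dots,B_m$ and the twice reduced functions $B^2_\eta$, $\eta\in\Xi_2$, over $\triangle^\ell_{\mathrm{PS}}$ defined in the context. Then $\mathbb S_2(\triangle^\ell_{\mathrm{PS}})$ contains (the restrictions to $\Omega$ of) all bivariate polynomials of total degree less than or equal to $3$.
   Context: **Triangulation and split.** $\triangle$ is a (conforming) triangulation of a bounded planar polygonal domain $\Omega$. For $\ell\in\mathbb N$, $\ell\ge1$, $\triangle^\ell$ is the refinement of $\triangle$ obtained by splitting each triangle of $\triangle$ uniformly into $\ell^2$ congruent triangles so that each edge of $\triangle$ is split into $\ell$ equal intervals. $V^\ell,E^\ell,T^\ell$ are the sets of vertices $v_i$, edges $e_j$, triangles $t_k$ of $\triangle^\ell$. In each $t_k\in T^\ell$ a split point $v_k^t$ is chosen in the interior of $t_k$ such that for any two triangles $t_k,t_{k'}$ sharing an edge $e_j$ the segment $[v_k^t,v_{k'}^t]$ meets the interior of $e_j$; the intersection point is called $v_j^e$. If $e_j$ is a boundary edge, $v_j^e$ is its midpoint. The Powell--Sabin refinement $\triangle^\ell_{\mathrm{PS}}$ is obtained by connecting each $v_k^t$ to the three vertices of $t_k$ and to the three split points on the edges of $t_k$ (six small triangles per $t_k$, each of the form $\langle v_i,v_j^e,v_k^t\rangle$). **Symmetric triangles.** A triangle $t_k\in T^\ell$ with vertices $v_{i_1},v_{i_2},v_{i_3}$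 has symmetric configuration if it has three neighbours in $\triangle^\ell$, these have vertices $\{v_{i_1},v_{i_2},v_{i_1}+v_{i_2}-v_{i_3}\}$, $\{v_{i_2},v_{i_3},v_{i_2}+v_{i_3}-v_{i_1}\}$, $\{v_{i_3},v_{i_1},v_{i_3}+v_{i_1}-v_{i_2}\}$, and the split points of $t_k$ and of its three neighbours are their barycenters. $T^\ell_{\mathrm{sym}}$ is the set of such triangles. **Cubic Powell--Sabin B-splines.** For each $v_i\in V^\ell$ a nondegenerate triangle $q_i^v$ is chosen that contains $v_i$ and all points $\frac23v_i+\frac13v_j^e$, $\frac23v_i+\frac13v_k^t$ for the edges $e_j$ and triangles $t_k$ of $\triangle^\ell$ attached to $v_i$. $\Xi_0$ is the set of triplets $(v_i,e_j,\tau)$, where $e_j\in E^\ell$, $v_i$ is an endpoint of $e_j$, and $\tau$ is a triangle of $T^\ell$ attached to $e_j$, or $\tau=\emptyset$ if $e_j$ is a boundary edge (so each edge gives four triplets). Given real coefficients $c_{i,r}$ ($v_i\in V^\ell$, $r=1,2,3$) and $c_\xi$ ($\xi\in\Xi_0$), define a continuous piecewise cubic $s$ on $\triangle^\ell_{\mathrm{PS}}$ through its Bernstein--Bézier ordinates on the small triangles; write $b(p_1,p_2,p_3)$ (symmetric in its arguments) for the ordinate at domain point $(p_1+p_2+p_3)/3$, where $p_1,p_2,p_3$ are (possibly repeated) vertices of a small triangle. - Let $L_i$ be the affine function taking value $c_{i,r}$ at the $r$-th vertex of $q_i^v$. Then $b(v_i,v_i,w)=L_i(\frac23v_i+\frac13w)$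 for $w=v_i$, $w=v_j^e$, $w=v_k^t$, with $e_j,t_k$ attached to $v_i$. - For $e_j$ with endpoints $v_i,v_{i'}$ write $v_j^e=\lambda v_i+\lambda'v_{i'}$, $\lambda+\lambda'=1$. For $t_k$ attached to $e_j$: $b(v_i,v_j^e,v_k^t)=\lambda\, b(v_i,v_i,v_k^t)+\lambda' c_{(v_i,e_j,t_k)}$, and analogously $b(v_{i'},v_j^e,v_k^t)=\lambda' b(v_{i'},v_{i'},v_k^t)+\lambda c_{(v_{i'},e_j,t_k)}$. - If $e_j$ is shared by $t_k,t_{k'}$ and $v_j^e=\mu v_k^t+\mu'v_{k'}^t$, $\mu+\mu'=1$, then $b(v_i,v_j^e,v_j^e)=\mu\, b(v_i,v_j^e,v_k^t)+\mu' b(v_i,v_j^e,v_{k'}^t)$ (same for $v_{i'}$). If $e_j$ is a boundary edge, then $b(v_i,v_j^e,v_j^e)=\lambda\, b(v_i,v_i,v_j^e)+\lambda' c_{(v_i,e_j,\emptyset)}$ and $b(v_{i'},v_j^e,v_j^e)=\lambda' b(v_{i'},v_{i'},v_j^e)+\lambda c_{(v_{i'},e_j,\emptyset)}$. - $b(v_j^e,v_j^e,w)=\lambda\, b(v_i,v_j^e,w)+\lambda' b(v_{i'},v_j^e,w)$ for $w\in\{v_j^e,v_k^t\}$. - If $t_k$ has vertices $v_{i_1},v_{i_2},v_{i_3}$ and $v_k^t=a_1v_{i_1}+a_2v_{i_2}+a_3v_{i_3}$, $a_1+a_2+a_3=1$, then $b(v_{i_1},v_k^t,v_k^t)=a_1b(v_{i_1},v_{i_1},v_k^t)+a_2c_{(v_{i_1},e_{12},t_k)}+a_3c_{(v_{i_1},e_{13},t_k)}$,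 where $e_{12},e_{13}$ are the edges $[v_{i_1},v_{i_2}]$, $[v_{i_1},v_{i_3}]$ (and analogously for $v_{i_2},v_{i_3}$); $b(v_j^e,v_k^t,v_k^t)=\lambda\, b(v_i,v_k^t,v_k^t)+\lambda' b(v_{i'},v_k^t,v_k^t)$; $b(v_k^t,v_k^t,v_k^t)=\sum_{n=1}^3a_n b(v_{i_n},v_k^t,v_k^t)$. The function $s$ with $c_{i,r}=1$ and all other coefficients $0$ is a vertex function; these are listed as $B_1,\dots,B_m$, $m=3|V^\ell|$. The function $s$ with $c_\xi=1$ and all other coefficients $0$ is denoted $B^0_\xi$, $\xi\in\Xi_0$. **First reduction.** $\Xi_1$ is the set of pairs $(e_j,\tau)$ with $e_j\in E^\ell$ and $\tau\in T^\ell$ attached to $e_j$, or $\tau=\emptyset$ if $e_j$ is a boundary edge. For an edge $e_j$ with endpoints $v_i,v_{i'}$ put $B^1_{(e_j,\tau)}=B^0_{(v_i,e_j,\tau)}+B^0_{(v_{i'},e_j,\tau)}$. **Second reduction.** $\Xi_2$ is the union of the set of pairs $(\emptyset,t_k)$, $t_k\in T^\ell_{\mathrm{sym}}$, and the set of pairs $(e_j,\tau)\in\Xi_1$ with $\tau\notin T^\ell_{\mathrm{sym}}$ ($\tau=\emptyset$ allowed). Put: - for $t_k\in T^\ell_{\mathrm{sym}}$: $B^2_{(\emptyset,t_k)}=\sum_{e_j}\big(\frac23B^1_{(e_j,t_k)}+\frac13B^1_{(e_j,t_{k'})}\big)$, the sum over the three edges $e_j$ of $t_k$, where $t_{k'}$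 is the other triangle attached to $e_j$; - for $(e_j,\tau)\in\Xi_2$ such that the other triangle $t_k$ attached to $e_j$ is in $T^\ell_{\mathrm{sym}}$: $B^2_{(e_j,\tau)}=\frac23B^1_{(e_j,\tau)}+\frac13B^1_{(e_j,t_k)}$; - for all other $(e_j,\tau)\in\Xi_2$: $B^2_{(e_j,\tau)}=B^1_{(e_j,\tau)}$. *)

theory Defs
  imports "HOL-Analysis.Analysis" "HOL-Library.Function_Algebras"
begin

type_synonym point = "real ^ 2"

text \<open>Triangles and edges are represented by their sets of vertices, so that vertex sets of size
  three, two and zero encode triangles, edges and the symbol \<open>\<emptyset>\<close>.\<close>

definition edges_of :: "point set \<Rightarrow> point set set" where
  "edges_of t = {e. e \<subseteq> t \<and> card e = 2}"

definition covered :: "point set set \<Rightarrow> point set" where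
  "covered T = (\<Union>t\<in>T. convex hull t)"

definition triangulation_of :: "point set \<Rightarrow> point set set \<Rightarrow> bool" where
  "triangulation_of \<Omega> T \<longleftrightarrow>
     finite T \<and>
     (\<forall>t\<in>T. card t = 3 \<and> \<not> affine_dependent t) \<and>
     (\<forall>t\<in>T. \<forall>t'\<in>T. convex hull t \<inter> convex hull t' = convex hull (t \<inter> t')) \<and>
     covered T = closure \<Omega>"

definition lattice_point :: "nat \<Rightarrow> point \<Rightarrow> point \<Rightarrow> point \<Rightarrow> nat \<Rightarrow> nat \<Rightarrow> nat \<Rightarrow> point" where
  "lattice_point l a b c i j k = (1 / real l) *\<^sub>R (real i *\<^sub>R a + real j *\<^sub>R b + real k *\<^sub>R c)"

text \<open>The first family consists of the translates of the scaled triangle \<open>abc\<close>, the second one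
  of the triangles turned by 180 degrees.\<close>

definition uniform_split :: "nat \<Rightarrow> point \<Rightarrow> point \<Rightarrow> point \<Rightarrow> point set set" where
  "uniform_split l a b c =
     {{lattice_point l a b c (i + 1) j k, lattice_point l a b c i (j + 1) k,
       lattice_point l a b c i j (k + 1)} | i j k. i + j + k + 1 = l} \<union>
     {{lattice_point l a b c i (j + 1) (k + 1), lattice_point l a b c (i + 1) j (k + 1),
       lattice_point l a b c (i + 1) (j + 1) k} | i j k. i + j + k + 2 = l}"

definition uniform_refinement :: "nat \<Rightarrow> point set set \<Rightarrow> point set set" where
  "uniform_refinement l T = {t. \<exists>a b c. {a, b, c} \<in> T \<and> t \<in> uniform_split l a b c}"

text \<open>Barycentric coordinates of \<open>x\<close> with respect to an affinely independent finite set \<open>S\<close> whose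
  affine hull contains \<open>x\<close>, as a function of the element of \<open>S\<close>.\<close>

definition bary :: "point set \<Rightarrow> point \<Rightarrow> point \<Rightarrow> real" where
  "bary S x = (THE u. (\<forall>v. v \<notin> S \<longrightarrow> u v = 0) \<and> (\<Sum>v\<in>S. u v) = 1 \<and> (\<Sum>v\<in>S. u v *\<^sub>R v) = x)"

definition barycenter :: "point set \<Rightarrow> point" where
  "barycenter t = (1 / 3) *\<^sub>R (\<Sum>v\<in>t. v)"

definition polynomials_of_degree_le :: "nat \<Rightarrow> (point \<Rightarrow> real) set" where
  "polynomials_of_degree_le n =
     {p. \<exists>a. \<forall>x. p x = (\<Sum>i\<le>n. \<Sum>j\<le>n - i. a i j * (x $ 1) ^ i * (x $ 2) ^ j)}"

interpretation real_fun: vector_space "\<lambda>(r::real) (f::point \<Rightarrow> real) x. r * f x"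
  by unfold_locales (auto simp: algebra_simps)

text \<open>\<open>T\<close> is the set of triangles, \<open>vt\<close> assigns the split point to a triangle and \<open>ve\<close> to an edge,
  \<open>q v\<close> lists the vertices of the triangle chosen for the vertex \<open>v\<close>. Spline coefficients are given
  by \<open>cv v r\<close> (vertex coefficients) and \<open>c (v, e, \<tau>)\<close>.\<close>

locale cubic_ps =
  fixes T :: "point set set"
    and vt ve :: "point set \<Rightarrow> point"
    and q :: "point \<Rightarrow> 3 \<Rightarrow> point"
begin

definition V :: "point set" where "V = \<Union>T"

definition E :: "point set set" where "E = (\<Union>t\<in>T. edges_of t)"

definition attached :: "point set \<Rightarrow> point set set" where
  "attached e = {t \<in> T. e \<subseteq> t}"

definition boundary_edge :: "point set \<Rightarrow> bool" where
  "boundary_edge e \<longleftrightarrow> e \<in> E \<and> card (attached e) = 1"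

definition powell_sabin_points :: bool where
  "powell_sabin_points \<longleftrightarrow>
     (\<forall>t\<in>T. vt t \<in> interior (convex hull t)) \<and>
     (\<forall>e\<in>E. \<forall>t\<in>attached e. \<forall>t'\<in>attached e. t \<noteq> t' \<longrightarrow>
        closed_segment (vt t) (vt t') \<inter> rel_interior (convex hull e) = {ve e}) \<and>
     (\<forall>e\<in>E. boundary_edge e \<longrightarrow> ve e = (1 / 2) *\<^sub>R (\<Sum>v\<in>e. v))"

definition control_triangles :: bool where
  "control_triangles \<longleftrightarrow>
     (\<forall>v\<in>V. inj (q v) \<and> \<not> affine_dependent (range (q v)) \<and>
        v \<in> convex hull (range (q v)) \<and>
        (\<forall>e\<in>E. v \<in> e \<longrightarrow> (2 / 3) *\<^sub>R v + (1 / 3) *\<^sub>R ve e \<in> convex hull (range (q v))) \<and>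
        (\<forall>t\<in>T. v \<in> t \<longrightarrow> (2 / 3) *\<^sub>R v + (1 / 3) *\<^sub>R vt t \<in> convex hull (range (q v))))"

definition neighbours :: "point set \<Rightarrow> point set set" where
  "neighbours t = {t' \<in> T. t' \<noteq> t \<and> card (t \<inter> t') = 2}"

definition T_sym :: "point set set" where
  "T_sym = {t \<in> T. \<exists>v1 v2 v3. t = {v1, v2, v3} \<and>
     neighbours t = {{v1, v2, v1 + v2 - v3}, {v2, v3, v2 + v3 - v1}, {v3, v1, v3 + v1 - v2}} \<and>
     (\<forall>t'\<in>insert t (neighbours t). vt t' = barycenter t')}"

text \<open>The affine function with value \<open>cv v r\<close> at \<open>q v r\<close>.\<close>

definition L :: "(point \<Rightarrow> 3 \<Rightarrow> real) \<Rightarrow> point \<Rightarrow> point \<Rightarrow> real" where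
  "L cv v x = (\<Sum>r\<in>UNIV. cv v r * bary (range (q v)) x (q v r))"

text \<open>The Bernstein-Bezier ordinates. In the names, \<open>v\<close>, \<open>e\<close>, \<open>t\<close> stand for the points \<open>v\<close>,
  \<open>ve e\<close>, \<open>vt t\<close>; for instance \<open>b_vet cv c v e t\<close> is the ordinate at the domain point
  \<open>(v + ve e + vt t) / 3\<close>. The last argument of \<open>b_vvw\<close> is a point.\<close>

definition b_vvw :: "(point \<Rightarrow> 3 \<Rightarrow> real) \<Rightarrow> point \<Rightarrow> point \<Rightarrow> real" where
  "b_vvw cv v w = L cv v ((2 / 3) *\<^sub>R v + (1 / 3) *\<^sub>R w)"

definition b_vet :: "(point \<Rightarrow> 3 \<Rightarrow> real) \<Rightarrow> (point \<times> point set \<times> point set \<Rightarrow> real) \<Rightarrow>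
    point \<Rightarrow> point set \<Rightarrow> point set \<Rightarrow> real" where
  "b_vet cv c v e t =
     bary e (ve e) v * b_vvw cv v (vt t) + (1 - bary e (ve e) v) * c (v, e, t)"

definition b_vee :: "(point \<Rightarrow> 3 \<Rightarrow> real) \<Rightarrow> (point \<times> point set \<times> point set \<Rightarrow> real) \<Rightarrow>
    point \<Rightarrow> point set \<Rightarrow> real" where
  "b_vee cv c v e =
     (if boundary_edge e
      then bary e (ve e) v * b_vvw cv v (ve e) + (1 - bary e (ve e) v) * c (v, e, {})
      else \<Sum>t\<in>attached e. bary (vt ` attached e) (ve e) (vt t) * b_vet cv c v e t)"

definition b_eee :: "(point \<Rightarrow> 3 \<Rightarrow> real) \<Rightarrow> (point \<times> point set \<times> point set \<Rightarrow> real) \<Rightarrow>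
    point set \<Rightarrow> real" where
  "b_eee cv c e = (\<Sum>v\<in>e. bary e (ve e) v * b_vee cv c v e)"

definition b_eet :: "(point \<Rightarrow> 3 \<Rightarrow> real) \<Rightarrow> (point \<times> point set \<times> point set \<Rightarrow> real) \<Rightarrow>
    point set \<Rightarrow> point set \<Rightarrow> real" where
  "b_eet cv c e t = (\<Sum>v\<in>e. bary e (ve e) v * b_vet cv c v e t)"

definition b_vtt :: "(point \<Rightarrow> 3 \<Rightarrow> real) \<Rightarrow> (point \<times> point set \<times> point set \<Rightarrow> real) \<Rightarrow>
    point \<Rightarrow> point set \<Rightarrow> real" where
  "b_vtt cv c v t =
     bary t (vt t) v * b_vvw cv v (vt t) +
     (\<Sum>w\<in>t - {v}. bary t (vt t) w * c (v, {v, w}, t))"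

definition b_ett :: "(point \<Rightarrow> 3 \<Rightarrow> real) \<Rightarrow> (point \<times> point set \<times> point set \<Rightarrow> real) \<Rightarrow>
    point set \<Rightarrow> point set \<Rightarrow> real" where
  "b_ett cv c e t = (\<Sum>v\<in>e. bary e (ve e) v * b_vtt cv c v t)"

definition b_ttt :: "(point \<Rightarrow> 3 \<Rightarrow> real) \<Rightarrow> (point \<times> point set \<times> point set \<Rightarrow> real) \<Rightarrow>
    point set \<Rightarrow> real" where
  "b_ttt cv c t = (\<Sum>v\<in>t. bary t (vt t) v * b_vtt cv c v t)"

text \<open>The cubic polynomial on the small triangle with vertices \<open>v\<close>, \<open>ve e\<close>, \<open>vt t\<close>.\<close>

definition piece :: "(point \<Rightarrow> 3 \<Rightarrow> real) \<Rightarrow> (point \<times> point set \<times> point set \<Rightarrow> real) \<Rightarrow>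
    point \<times> point set \<times> point set \<Rightarrow> point \<Rightarrow> real" where
  "piece cv c = (\<lambda>(v, e, t) x.
     let u = bary {v, ve e, vt t} x;
         \<alpha> = u v; \<beta> = u (ve e); \<gamma> = u (vt t)
     in \<alpha> ^ 3 * b_vvw cv v v
      + 3 * \<alpha> ^ 2 * \<beta> * b_vvw cv v (ve e)
      + 3 * \<alpha> ^ 2 * \<gamma> * b_vvw cv v (vt t)
      + 3 * \<alpha> * \<beta> ^ 2 * b_vee cv c v e
      + 6 * \<alpha> * \<beta> * \<gamma> * b_vet cv c v e t
      + 3 * \<alpha> * \<gamma> ^ 2 * b_vtt cv c v t
      + \<beta> ^ 3 * b_eee cv c e
      + 3 * \<beta> ^ 2 * \<gamma> * b_eet cv c e t
      + 3 * \<beta> * \<gamma> ^ 2 * b_ett cv c e t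
      + \<gamma> ^ 3 * b_ttt cv c t)"

definition small_triangles :: "(point \<times> point set \<times> point set) set" where
  "small_triangles = {(v, e, t). t \<in> T \<and> e \<in> edges_of t \<and> v \<in> e}"

text \<open>The choice of the small triangle containing \<open>x\<close> is immaterial: the ordinates on a common edge
  of two small triangles coincide. Splines are extended by zero outside the triangulated region.\<close>

definition spline :: "(point \<Rightarrow> 3 \<Rightarrow> real) \<Rightarrow> (point \<times> point set \<times> point set \<Rightarrow> real) \<Rightarrow>
    point \<Rightarrow> real" where
  "spline cv c x =
     (if x \<in> covered T
      then piece cv c
        (SOME (v, e, t). (v, e, t) \<in> small_triangles \<and> x \<in> convex hull {v, ve e, vt t}) x
      else 0)"

definition B_vertex :: "point \<Rightarrow> 3 \<Rightarrow> point \<Rightarrow> real" where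
  "B_vertex v r = spline (\<lambda>v' r'. if v' = v \<and> r' = r then 1 else 0) (\<lambda>_. 0)"

definition B0 :: "point \<times> point set \<times> point set \<Rightarrow> point \<Rightarrow> real" where
  "B0 \<xi> = spline (\<lambda>_ _. 0) (\<lambda>\<xi>'. if \<xi>' = \<xi> then 1 else 0)"

definition Xi1 :: "(point set \<times> point set) set" where
  "Xi1 = {(e, \<tau>). e \<in> E \<and> (\<tau> \<in> attached e \<or> boundary_edge e \<and> \<tau> = {})}"

definition B1 :: "point set \<times> point set \<Rightarrow> point \<Rightarrow> real" where
  "B1 = (\<lambda>(e, \<tau>) x. \<Sum>v\<in>e. B0 (v, e, \<tau>) x)"

definition other :: "point set \<Rightarrow> point set \<Rightarrow> point set" where
  "other e \<tau> = (THE t. t \<in> attached e \<and> t \<noteq> \<tau>)"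

definition Xi2 :: "(point set \<times> point set) set" where
  "Xi2 = {({}, t) | t. t \<in> T_sym} \<union> {(e, \<tau>). (e, \<tau>) \<in> Xi1 \<and> \<tau> \<notin> T_sym}"

definition B2 :: "point set \<times> point set \<Rightarrow> point \<Rightarrow> real" where
  "B2 = (\<lambda>(e, \<tau>) x.
     if e = {} then
       \<Sum>e'\<in>edges_of \<tau>. 2 / 3 * B1 (e', \<tau>) x + 1 / 3 * B1 (e', other e' \<tau>) x
     else if \<exists>t\<in>T_sym. t \<in> attached e \<and> t \<noteq> \<tau> then
       2 / 3 * B1 (e, \<tau>) x + 1 / 3 * B1 (e, other e \<tau>) x
     else B1 (e, \<tau>) x)"

definition S2 :: "(point \<Rightarrow> real) set" where
  "S2 = real_fun.span ({B_vertex v r | v r. v \<in> V} \<union> {B2 \<eta> | \<eta>. \<eta> \<in> Xi2})"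

end

end

(* A cubic p has a blossom P, the symmetric triaffine map with P(x, x, x) = p(x), and the
   Bernstein-Bezier ordinate of p at (x + y + z) / 3 is P(x, y, z). Every averaging rule that defines
   the ordinates of the spline is an instance of affinity of P in one argument, so p is the spline
   with c_{i,r} = P(v_i, v_i, 3 q_{i,r} - 2 v_i), c_{(v,e,t)} = P(v, w, v^t) and
   c_{(v,e,{})} = P(v, w, v^e) for e = {v, w}. The values at (v, e, tau) and (w, e, tau) agree, which
   is the first reduction. If t = {v, w, z} is symmetric and t' is its neighbour across e = {v, w},
   then by the barycentric positions of the split points 2 c_{(e,t)} - c_{(e,t')} = P(v, w, z), which
   does not depend on the choice of e. Since d = 2/3 (2 d - d') + 1/3 (2 d' - d), the numbers
   2 c_{(e,tau)} - c_{(e,tau')} are therefore the coefficients in the twice reduced functions. *)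

theory Submission
  imports Defs
begin

section \<open>Affine functions and barycentric coordinates\<close>

definition affine_fun :: "(point \<Rightarrow> real) \<Rightarrow> bool" where
  "affine_fun f \<longleftrightarrow> (\<exists>a d. \<forall>x. f x = a \<bullet> x + d)"

lemma affine_fun_sum:
  assumes "affine_fun f" "sum u S = 1"
  shows "f (\<Sum>v\<in>S. u v *\<^sub>R v) = (\<Sum>v\<in>S. u v * f v)"
proof -
  obtain a d where f: "f = (\<lambda>x. a \<bullet> x + d)"
    using assms(1) unfolding affine_fun_def by auto
  have "(\<Sum>v\<in>S. u v * f v) = (\<Sum>v\<in>S. u v * (a \<bullet> v)) + sum u S * d"
    unfolding f by (simp add: distrib_left sum.distrib sum_distrib_right)
  then show ?thesis
    using assms(2) by (simp add: f inner_sum_right)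
qed

lemma affine_fun_combination3:
  assumes "affine_fun f" "\<alpha> + \<beta> + \<gamma> = 1"
  shows "f (\<alpha> *\<^sub>R x + \<beta> *\<^sub>R y + \<gamma> *\<^sub>R z) = \<alpha> * f x + \<beta> * f y + \<gamma> * f z"
proof -
  obtain a d where f: "f = (\<lambda>x. a \<bullet> x + d)"
    using assms(1) unfolding affine_fun_def by auto
  have "d = (\<alpha> + \<beta> + \<gamma>) * d" using assms(2) by simp
  then show ?thesis unfolding f by (simp add: inner_add_right algebra_simps)
qed

lemma affine_fun_cmult: "affine_fun f \<Longrightarrow> affine_fun (\<lambda>x. c * f x)"
  unfolding affine_fun_def
  by (metis distrib_left inner_scaleR_left)

lemma affine_fun_add:
  assumes "affine_fun f" "affine_fun g" shows "affine_fun (\<lambda>x. f x + g x)"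
proof -
  obtain a d b e where "f = (\<lambda>x. a \<bullet> x + d)" "g = (\<lambda>x. b \<bullet> x + e)"
    using assms unfolding affine_fun_def by (auto simp: fun_eq_iff)
  then have "f x + g x = (a + b) \<bullet> x + (d + e)" for x
    by (simp add: inner_add_left)
  then show ?thesis unfolding affine_fun_def by blast
qed

lemma affine_fun_const: "affine_fun (\<lambda>x. c)"
  unfolding affine_fun_def by (metis add.left_neutral inner_zero_left)

lemma affine_fun_nth: "affine_fun (\<lambda>x. x $ i)"
  unfolding affine_fun_def by (metis add.right_neutral inner_axis' inner_real_def mult_1)

lemma affine_fun_rescale:
  assumes "affine_fun f" shows "affine_fun (\<lambda>x. f (a *\<^sub>R x + b))"
proof -
  obtain c d where "f = (\<lambda>x. c \<bullet> x + d)"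
    using assms unfolding affine_fun_def by auto
  then have "f (a *\<^sub>R x + b) = (a *\<^sub>R c) \<bullet> x + (c \<bullet> b + d)" for x
    by (simp add: inner_add_right)
  then show ?thesis unfolding affine_fun_def by blast
qed

text \<open>\<open>bary\<close> is a definite description: weights exist because \<open>x\<close>
  lies in the affine hull, and two choices differ by an affine dependence of \<open>S\<close>, hence
  not at all. Prescribing zero off \<open>S\<close> makes the whole function unique.\<close>

lemma
  fixes S :: "point set"
  assumes S: "\<not> affine_dependent S" and x: "x \<in> affine hull S"
  shows sum_bary: "(\<Sum>v\<in>S. bary S x v) = 1"
    and sum_bary_scaleR: "(\<Sum>v\<in>S. bary S x v *\<^sub>R v) = x"
proof -
  have fin: "finite S" using S by (rule aff_independent_finite)
  let ?P = "\<lambda>u. (\<forall>v. v \<notin> S \<longrightarrow> u v = 0) \<and> (\<Sum>v\<in>S. u v) = 1 \<and> (\<Sum>v\<in>S. u v *\<^sub>R v) = x"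
  obtain u where u: "sum u S = 1" "(\<Sum>v\<in>S. u v *\<^sub>R v) = x"
    using x affine_hull_finite[OF fin] by auto
  define u' where "u' = (\<lambda>v. if v \<in> S then u v else 0)"
  have "?P u'"
    using u by (simp add: u'_def if_distrib cong: if_cong)
  moreover have "w = u'" if w: "?P w" for w
  proof -
    have "sum (\<lambda>v. w v - u' v) S = 0"
      using w \<open>?P u'\<close> by (simp add: sum_subtractf)
    moreover have "(\<Sum>v\<in>S. (w v - u' v) *\<^sub>R v) = 0"
      using w \<open>?P u'\<close> by (simp add: scaleR_left_diff_distrib sum_subtractf)
    ultimately have "\<not> (\<exists>v\<in>S. w v - u' v \<noteq> 0)"
      using S affine_dependent_explicit_finite[OF fin] by blast
    then show "w = u'"
      using w by (auto simp: u'_def)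
  qed
  ultimately have "?P (bary S x)"
    unfolding bary_def by (rule theI)
  then show "(\<Sum>v\<in>S. bary S x v) = 1" "(\<Sum>v\<in>S. bary S x v *\<^sub>R v) = x"
    by auto
qed

lemma affine_fun_bary:
  assumes "affine_fun f" "\<not> affine_dependent S" "x \<in> affine hull S"
  shows "(\<Sum>v\<in>S. bary S x v * f v) = f x"
  using affine_fun_sum[OF assms(1) sum_bary[OF assms(2,3)]] sum_bary_scaleR[OF assms(2,3)]
  by simp

section \<open>Blossoms\<close>

text \<open>The two transpositions generate all permutations of the arguments, so affinity in the
  first argument carries over to the others.\<close>

definition blossom :: "(point \<Rightarrow> point \<Rightarrow> point \<Rightarrow> real) \<Rightarrow> bool" where
  "blossom P \<longleftrightarrow> (\<forall>x y z. P x y z = P y x z) \<and> (\<forall>x y z. P x y z = P x z y) \<and>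
     (\<forall>y z. affine_fun (\<lambda>x. P x y z))"

lemma blossom_swap12: "blossom P \<Longrightarrow> P x y z = P y x z"
  unfolding blossom_def by blast

lemma blossom_swap23: "blossom P \<Longrightarrow> P x y z = P x z y"
  unfolding blossom_def by blast

lemma blossom_affine1: "blossom P \<Longrightarrow> affine_fun (\<lambda>x. P x y z)"
  unfolding blossom_def by blast

lemma blossom_affine2:
  assumes "blossom P" shows "affine_fun (\<lambda>y. P x y z)"
proof -
  have "(\<lambda>y. P x y z) = (\<lambda>y. P y x z)"
    using blossom_swap12[OF assms] by blast
  then show ?thesis using blossom_affine1[OF assms] by simp
qed

lemma blossom_affine3:
  assumes "blossom P" shows "affine_fun (\<lambda>z. P x y z)"
proof -
  have "(\<lambda>z. P x y z) = (\<lambda>z. P x z y)"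
    using blossom_swap23[OF assms] by blast
  then show ?thesis using blossom_affine2[OF assms] by simp
qed

lemma blossom_add:
  "blossom P \<Longrightarrow> blossom Q \<Longrightarrow> blossom (\<lambda>x y z. P x y z + Q x y z)"
  unfolding blossom_def by (auto intro: affine_fun_add)

lemma blossom_cmult: "blossom P \<Longrightarrow> blossom (\<lambda>x y z. c * P x y z)"
  unfolding blossom_def by (auto intro: affine_fun_cmult)

lemma blossom_zero: "blossom (\<lambda>x y z. 0)"
  unfolding blossom_def by (auto intro: affine_fun_const)

lemma blossom_sum:
  "finite I \<Longrightarrow> (\<And>i. i \<in> I \<Longrightarrow> blossom (P i)) \<Longrightarrow> blossom (\<lambda>x y z. \<Sum>i\<in>I. P i x y z)"
  by (induction I rule: finite_induct) (auto intro: blossom_add blossom_zero)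

text \<open>The symmetrization of \<open>f x * g y * h z\<close>: the six summands are the
  permutations, and 1/6 makes the diagonal equal to \<open>f x * g x * h x\<close>.\<close>

lemma blossom_product:
  assumes "affine_fun f" "affine_fun g" "affine_fun h"
  shows "blossom (\<lambda>x y z. (1 / 6) * (f x * (g y * h z + g z * h y) + f y * (g x * h z + g z * h x)
    + f z * (g x * h y + g y * h x)))" (is "blossom ?P")
proof -
  have "affine_fun (\<lambda>x. ?P x y z)" for y z
  proof -
    have "(\<lambda>x. ?P x y z) = (\<lambda>x. (1 / 6) * ((g y * h z + g z * h y) * f x +
        ((f y * h z + f z * h y) * g x + (f y * g z + f z * g y) * h x)))"
      by (rule ext) (simp add: algebra_simps)
    moreover have "affine_fun \<dots>"
      by (intro affine_fun_cmult affine_fun_add assms)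
    ultimately show ?thesis by simp
  qed
  moreover have "?P x y z = ?P y x z" "?P x y z = ?P x z y" for x y z
    by (simp_all add: algebra_simps)
  ultimately show ?thesis unfolding blossom_def by blast
qed

section \<open>Blossoms of cubic polynomials\<close>

lemma monomial_as_product:
  assumes "i + j \<le> 3"
  shows "\<exists>f g h. affine_fun f \<and> affine_fun g \<and> affine_fun h \<and>
    (\<forall>x. x $ 1 ^ i * x $ 2 ^ j = f x * g x * h x)"
proof -
  \<comment> \<open>The list of factors: \<open>i\<close> first coordinates, then \<open>j\<close>
    second coordinates, padded with the constant 1 up to three factors.\<close>
  define F :: "nat \<Rightarrow> point \<Rightarrow> real" where
    "F k = (if k < i then (\<lambda>x. x $ 1) else if k < i + j then (\<lambda>x. x $ 2) else (\<lambda>x. 1))" for k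
  have "affine_fun (F k)" for k
    by (auto simp: F_def affine_fun_nth affine_fun_const)
  moreover have "x $ 1 ^ i * x $ 2 ^ j = F 0 x * F 1 x * F 2 x" for x
  proof -
    have "i = 0 \<or> i = 1 \<or> i = 2 \<or> i = 3" "j = 0 \<or> j = 1 \<or> j = 2 \<or> j = 3"
      using assms by linarith+
    then show ?thesis
      using assms by (elim disjE) (simp_all add: F_def power2_eq_square power3_eq_cube)
  qed
  ultimately show ?thesis by blast
qed

text \<open>Symmetrizing each monomial of degree at most 3 gives a blossom, and blossoms are closed
  under linear combinations.\<close>

lemma cubic_has_blossom:
  assumes "p \<in> polynomials_of_degree_le 3"
  obtains P where "blossom P" "\<And>x. P x x x = p x"
proof -
  obtain a where p: "\<And>x. p x = (\<Sum>i\<le>3. \<Sum>j\<le>3 - i. a i j * (x $ 1) ^ i * (x $ 2) ^ j)"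
    using assms unfolding polynomials_of_degree_le_def by auto
  have "\<exists>M. blossom M \<and> (\<forall>x. M x x x = x $ 1 ^ i * x $ 2 ^ j)" if "i + j \<le> 3" for i j
  proof -
    obtain f g h where fgh: "affine_fun f" "affine_fun g" "affine_fun h"
      and *: "\<And>x. x $ 1 ^ i * x $ 2 ^ j = f x * g x * h x"
      using monomial_as_product[OF \<open>i + j \<le> 3\<close>] by blast
    show ?thesis
      by (rule exI, rule conjI, rule blossom_product[OF fgh]) (simp add: *)
  qed
  then obtain M where M: "\<And>i j. i + j \<le> 3 \<Longrightarrow> blossom (M i j)"
      "\<And>i j x. i + j \<le> 3 \<Longrightarrow> M i j x x x = x $ 1 ^ i * x $ 2 ^ j"
    by metis
  show thesis
  proof
    show "blossom (\<lambda>x y z. \<Sum>i\<le>3. \<Sum>j\<le>3 - i. a i j * M i j x y z)"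
      by (intro blossom_sum blossom_cmult M(1)) auto
    show "(\<Sum>i\<le>3. \<Sum>j\<le>3 - i. a i j * M i j x x x) = p x" for x
      unfolding p by (intro sum.cong refl) (auto simp: M(2))
  qed
qed

text \<open>Expanding every argument yields 27 terms, which symmetry collects with the multinomial
  factors 1, 3 and 6. This is the Bernstein-Bezier form used in \<open>piece\<close>.\<close>

lemma blossom_expand:
  assumes P: "blossom P" and 1: "\<alpha> + \<beta> + \<gamma> = 1"
    and x: "x = \<alpha> *\<^sub>R a + \<beta> *\<^sub>R b + \<gamma> *\<^sub>R c"
  shows "P x x x = \<alpha> ^ 3 * P a a a + 3 * \<alpha> ^ 2 * \<beta> * P a a b + 3 * \<alpha> ^ 2 * \<gamma> * P a a c
    + 3 * \<alpha> * \<beta> ^ 2 * P a b b + 6 * \<alpha> * \<beta> * \<gamma> * P a b c + 3 * \<alpha> * \<gamma> ^ 2 * P a c c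
    + \<beta> ^ 3 * P b b b + 3 * \<beta> ^ 2 * \<gamma> * P b b c + 3 * \<beta> * \<gamma> ^ 2 * P b c c + \<gamma> ^ 3 * P c c c"
proof -
  have e1: "P x y z = \<alpha> * P a y z + \<beta> * P b y z + \<gamma> * P c y z" for y z
    unfolding x by (rule affine_fun_combination3[OF blossom_affine1[OF P] 1])
  have e2: "P y x z = \<alpha> * P y a z + \<beta> * P y b z + \<gamma> * P y c z" for y z
    unfolding x by (rule affine_fun_combination3[OF blossom_affine2[OF P] 1])
  have e3: "P y z x = \<alpha> * P y z a + \<beta> * P y z b + \<gamma> * P y z c" for y z
    unfolding x by (rule affine_fun_combination3[OF blossom_affine3[OF P] 1])
  have s: "P a b a = P a a b" "P b a a = P a a b" "P a c a = P a a c" "P c a a = P a a c"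
    "P b a b = P a b b" "P b b a = P a b b" "P c a c = P a c c" "P c c a = P a c c"
    "P c b c = P b c c" "P c c b = P b c c" "P b c b = P b b c" "P c b b = P b b c"
    "P a c b = P a b c" "P b a c = P a b c" "P b c a = P a b c" "P c a b = P a b c" "P c b a = P a b c"
    using blossom_swap12[OF P] blossom_swap23[OF P] by metis+
  show ?thesis
    unfolding e1 e2 e3 s by (simp add: algebra_simps power2_eq_square power3_eq_cube)
qed

section \<open>The uniform split\<close>

lemma lattice_point_in_hull:
  assumes "i + j + k = l" "l \<ge> 1"
  shows "lattice_point l a b c i j k \<in> convex hull {a, b, c}"
proof -
  have "real i / real l + real j / real l + real k / real l = 1"
    using assms by (simp add: divide_simps flip: of_nat_add)
  then show ?thesis
    unfolding convex_hull_3 lattice_point_def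
    by (intro CollectI exI[of _ "real i / real l"] exI[of _ "real j / real l"]
        exI[of _ "real k / real l"]) (auto simp: scaleR_add_right)
qed

lemma uniform_split_subset:
  assumes "l \<ge> 1" "t \<in> uniform_split l a b c"
  shows "t \<subseteq> convex hull {a, b, c}"
  using assms unfolding uniform_split_def
  by (auto intro!: lattice_point_in_hull)

lemma finite_uniform_split: "finite (uniform_split l a b c)"
proof -
  \<comment> \<open>A finite supply of lattice points: all vertices of the split have indices at
    most \<open>l\<close>.\<close>
  define N where "N = (\<Union>i\<le>l. \<Union>j\<le>l. \<Union>k\<le>l. {lattice_point l a b c i j k})"
  have N: "lattice_point m a b c i j k \<in> N" if "l = m" "i \<le> m" "j \<le> m" "k \<le> m" for m i j k
    using that unfolding N_def by blast
  have "uniform_split l a b c \<subseteq> Pow N"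
    unfolding uniform_split_def by (auto intro!: N)
  then show ?thesis
    by (rule finite_subset) (simp add: N_def)
qed

text \<open>For arbitrary \<open>a b c\<close> lattice points may coincide, hence an upper bound;
  \<open>card_T\<close> later recovers equality from the split points.\<close>

lemma card_uniform_split_le:
  "t \<in> uniform_split l a b c \<Longrightarrow> finite t \<and> card t \<le> 3"
  unfolding uniform_split_def by (auto simp: card_insert_if)

text \<open>Scale the barycentric coordinates of \<open>x\<close> by \<open>l\<close>. The integer
  parts select a lattice cell, and the sum of the fractional parts decides which kind of small
  triangle contains \<open>x\<close>.\<close>

lemma uniform_split_covers:
  assumes l: "l \<ge> 1" and x: "x \<in> convex hull {a, b, c}"
  shows "\<exists>t\<in>uniform_split l a b c. x \<in> convex hull t"
proof -
  obtain u v w where uvw: "0 \<le> u" "0 \<le> v" "0 \<le> w" "u + v + w = 1"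
    and x: "x = u *\<^sub>R a + v *\<^sub>R b + w *\<^sub>R c"
    using x unfolding convex_hull_3 by auto
  let ?l = "real l"
  define i j k where "i = nat \<lfloor>?l * u\<rfloor>" "j = nat \<lfloor>?l * v\<rfloor>" "k = nat \<lfloor>?l * w\<rfloor>"
  define f g h where "f = ?l * u - i" "g = ?l * v - j" "h = ?l * w - k"
  have nn: "0 \<le> ?l * u" "0 \<le> ?l * v" "0 \<le> ?l * w" using uvw by auto
  have fr: "0 \<le> f" "f < 1" "0 \<le> g" "g < 1" "0 \<le> h" "h < 1"
    using nn unfolding i_j_k_def f_g_h_def by (auto simp: of_nat_nat) linarith+
  have "?l * u + ?l * v + ?l * w = ?l" using uvw(4) by (metis distrib_left mult.right_neutral)
  then have tot: "f + g + h = real l - real (i + j + k)" unfolding f_g_h_def by simp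
  have "real (i + j + k) \<le> real l" "real l < real (i + j + k + 3)" using tot fr by linarith+
  then have "i + j + k \<le> l" "l < i + j + k + 3" by linarith+
  \<comment> \<open>The fractional parts sum to an integer below 3.\<close>
  then consider "i + j + k = l" | "i + j + k + 1 = l" | "i + j + k + 2 = l" by linarith
  moreover have x': "x = (1 / ?l) *\<^sub>R ((i + f) *\<^sub>R a + (j + g) *\<^sub>R b + (k + h) *\<^sub>R c)"
    using l unfolding x f_g_h_def by (simp add: scaleR_add_right)
  \<comment> \<open>An opaque name for \<open>1 / l\<close> keeps the later identities
    polynomial.\<close>
  moreover obtain r where r: "1 / ?l = r" by blast
  ultimately show ?thesis
  proof cases
    case 1
    then have z: "f = 0" "g = 0" "h = 0" using tot fr by linarith+
    have xl: "x = lattice_point l a b c i j k"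
      using x' unfolding z lattice_point_def by simp
    \<comment> \<open>Here \<open>x\<close> is a lattice point; lowering a positive index by one
      gives a translated triangle that has \<open>x\<close> as a vertex.\<close>
    have "i \<ge> 1 \<or> j \<ge> 1 \<or> k \<ge> 1" using 1 l by linarith
    then show ?thesis
    proof (elim disjE)
      assume "1 \<le> i"
      then obtain i' where "i = i' + 1" by (metis add.commute le_Suc_ex)
      moreover have "{lattice_point l a b c (i' + 1) j k, lattice_point l a b c i' (j + 1) k,
        lattice_point l a b c i' j (k + 1)} \<in> uniform_split l a b c"
        using 1 \<open>i = i' + 1\<close> unfolding uniform_split_def by auto
      ultimately show ?thesis using xl by (meson hull_inc insertI1)
    next
      assume "1 \<le> j"
      then obtain j' where "j = j' + 1" by (metis add.commute le_Suc_ex)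
      moreover have "{lattice_point l a b c (i + 1) j' k, lattice_point l a b c i (j' + 1) k,
        lattice_point l a b c i j' (k + 1)} \<in> uniform_split l a b c"
        using 1 \<open>j = j' + 1\<close> unfolding uniform_split_def by auto
      ultimately show ?thesis using xl by (meson hull_inc insertI1 insertI2)
    next
      assume "1 \<le> k"
      then obtain k' where "k = k' + 1" by (metis add.commute le_Suc_ex)
      moreover have "{lattice_point l a b c (i + 1) j k', lattice_point l a b c i (j + 1) k',
        lattice_point l a b c i j (k' + 1)} \<in> uniform_split l a b c"
        using 1 \<open>k = k' + 1\<close> unfolding uniform_split_def by auto
      ultimately show ?thesis using xl by (meson hull_inc insertI1 insertI2)
    qed
  next
    case 2
    then have s: "f + g + h = 1" using tot by linarith
    let ?p = "lattice_point l a b c (i + 1) j k" and ?q = "lattice_point l a b c i (j + 1) k"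
      and ?r = "lattice_point l a b c i j (k + 1)"
    have h: "h = 1 - f - g" using s by linarith
    have "x = f *\<^sub>R ?p + g *\<^sub>R ?q + h *\<^sub>R ?r"
      unfolding x' lattice_point_def h r by (simp add: algebra_simps)
    then have "x \<in> convex hull {?p, ?q, ?r}"
      unfolding convex_hull_3 using fr s by blast
    moreover have "{?p, ?q, ?r} \<in> uniform_split l a b c"
      using 2 unfolding uniform_split_def by blast
    ultimately show ?thesis by blast
  next
    case 3
    then have s: "f + g + h = 2" using tot by linarith
    let ?p = "lattice_point l a b c i (j + 1) (k + 1)" and ?q = "lattice_point l a b c (i + 1) j (k + 1)"
      and ?r = "lattice_point l a b c (i + 1) (j + 1) k"
    have h: "h = 2 - f - g" using s by linarith
    \<comment> \<open>In the turned triangle the weights are the complements of the fractional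
      parts, with sum 3 - 2 = 1.\<close>
    have "x = (1 - f) *\<^sub>R ?p + (1 - g) *\<^sub>R ?q + (1 - h) *\<^sub>R ?r"
      unfolding x' lattice_point_def h r by (simp add: vec_eq_iff algebra_simps)
    moreover have "0 \<le> 1 - f" "0 \<le> 1 - g" "0 \<le> 1 - h" "(1 - f) + (1 - g) + (1 - h) = 1"
      using fr s by linarith+
    ultimately have "x \<in> convex hull {?p, ?q, ?r}"
      unfolding convex_hull_3 by blast
    moreover have "{?p, ?q, ?r} \<in> uniform_split l a b c"
      using 3 unfolding uniform_split_def by blast
    ultimately show ?thesis by blast
  qed
qed

lemma covered_uniform_refinement:
  assumes "l \<ge> 1" "\<forall>t\<in>T. card t = 3"
  shows "covered (uniform_refinement l T) = covered T"
proof
  show "covered (uniform_refinement l T) \<subseteq> covered T"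
  proof
    fix x assume "x \<in> covered (uniform_refinement l T)"
    then obtain t a b c where "x \<in> convex hull t" "{a, b, c} \<in> T" "t \<in> uniform_split l a b c"
      unfolding covered_def uniform_refinement_def by auto
    moreover have "convex hull t \<subseteq> convex hull {a, b, c}"
      using uniform_split_subset[OF assms(1) \<open>t \<in> _\<close>] by (simp add: hull_minimal)
    ultimately show "x \<in> covered T" unfolding covered_def by blast
  qed
  show "covered T \<subseteq> covered (uniform_refinement l T)"
  proof
    fix x assume "x \<in> covered T"
    then obtain t where t: "t \<in> T" "x \<in> convex hull t"
      unfolding covered_def by auto
    then obtain a b c where abc: "t = {a, b, c}"
      using assms(2) by (meson card_3_iff)
    then obtain t' where "t' \<in> uniform_split l a b c" "x \<in> convex hull t'"
      using uniform_split_covers[OF assms(1)] t(2) by metis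
    then show "x \<in> covered (uniform_refinement l T)"
      unfolding covered_def uniform_refinement_def using t abc by blast
  qed
qed

lemma finite_uniform_refinement:
  assumes "finite T" "\<forall>t\<in>T. card t = 3"
  shows "finite (uniform_refinement l T)"
proof -
  have fin: "finite (\<Union>T)" using assms by (metis card.infinite finite_Union zero_neq_numeral)
  have "uniform_refinement l T \<subseteq> (\<Union>a\<in>\<Union>T. \<Union>b\<in>\<Union>T. \<Union>c\<in>\<Union>T. uniform_split l a b c)"
    unfolding uniform_refinement_def by blast
  then show ?thesis
    by (rule finite_subset) (intro finite_UN_I fin finite_uniform_split)
qed

section \<open>Linearity of the spline in its coefficients\<close>

context cubic_ps
begin

text \<open>One scaled plus one plain family is the induction step for finite linear combinations,
  hence this form throughout the section.\<close>

lemma L_linear: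
  "L (\<lambda>v r. a * cv v r + cv' v r) v x = a * L cv v x + L cv' v x"
  unfolding L_def by (simp add: algebra_simps sum.distrib sum_distrib_left)

lemma b_vvw_linear:
  "b_vvw (\<lambda>v r. a * cv v r + cv' v r) v w = a * b_vvw cv v w + b_vvw cv' v w"
  unfolding b_vvw_def by (rule L_linear)

lemma b_vet_linear:
  "b_vet (\<lambda>v r. a * cv v r + cv' v r) (\<lambda>\<xi>. a * c \<xi> + c' \<xi>) v e t =
    a * b_vet cv c v e t + b_vet cv' c' v e t"
  unfolding b_vet_def b_vvw_linear by (simp add: algebra_simps)

lemma b_vee_linear:
  "b_vee (\<lambda>v r. a * cv v r + cv' v r) (\<lambda>\<xi>. a * c \<xi> + c' \<xi>) v e =
    a * b_vee cv c v e + b_vee cv' c' v e"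
  unfolding b_vee_def b_vvw_linear b_vet_linear
  by (simp add: algebra_simps sum.distrib sum_distrib_left)

lemma b_eee_linear:
  "b_eee (\<lambda>v r. a * cv v r + cv' v r) (\<lambda>\<xi>. a * c \<xi> + c' \<xi>) e =
    a * b_eee cv c e + b_eee cv' c' e"
  unfolding b_eee_def b_vee_linear
  by (simp add: algebra_simps sum.distrib sum_distrib_left)

lemma b_eet_linear:
  "b_eet (\<lambda>v r. a * cv v r + cv' v r) (\<lambda>\<xi>. a * c \<xi> + c' \<xi>) e t =
    a * b_eet cv c e t + b_eet cv' c' e t"
  unfolding b_eet_def b_vet_linear
  by (simp add: algebra_simps sum.distrib sum_distrib_left)

lemma b_vtt_linear:
  "b_vtt (\<lambda>v r. a * cv v r + cv' v r) (\<lambda>\<xi>. a * c \<xi> + c' \<xi>) v t =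
    a * b_vtt cv c v t + b_vtt cv' c' v t"
  unfolding b_vtt_def b_vvw_linear
  by (simp add: algebra_simps sum.distrib sum_distrib_left)

lemma b_ett_linear:
  "b_ett (\<lambda>v r. a * cv v r + cv' v r) (\<lambda>\<xi>. a * c \<xi> + c' \<xi>) e t =
    a * b_ett cv c e t + b_ett cv' c' e t"
  unfolding b_ett_def b_vtt_linear
  by (simp add: algebra_simps sum.distrib sum_distrib_left)

lemma b_ttt_linear:
  "b_ttt (\<lambda>v r. a * cv v r + cv' v r) (\<lambda>\<xi>. a * c \<xi> + c' \<xi>) t =
    a * b_ttt cv c t + b_ttt cv' c' t"
  unfolding b_ttt_def b_vtt_linear
  by (simp add: algebra_simps sum.distrib sum_distrib_left)

text \<open>The small triangle selected by \<open>spline\<close> depends on \<open>x\<close> alone,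
  so linearity passes on from a single piece.\<close>

lemma spline_linear:
  "spline (\<lambda>v r. a * cv v r + cv' v r) (\<lambda>\<xi>. a * c \<xi> + c' \<xi>) x =
    a * spline cv c x + spline cv' c' x"
proof -
  have "piece (\<lambda>v r. a * cv v r + cv' v r) (\<lambda>\<xi>. a * c \<xi> + c' \<xi>) s x =
      a * piece cv c s x + piece cv' c' s x" for s
    by (cases s)
      (simp add: piece_def Let_def b_vvw_linear b_vet_linear b_vee_linear b_eee_linear
        b_eet_linear b_vtt_linear b_ett_linear b_ttt_linear distrib_left mult.left_commute)
  then show ?thesis unfolding spline_def by simp
qed

lemma spline_zero: "spline (\<lambda>_ _. 0) (\<lambda>_. 0) x = 0"
  \<comment> \<open>At zero coefficients and with factor 1, linearity reads s = s + s.\<close>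
  using spline_linear[of 1 "\<lambda>_ _. 0" "\<lambda>_ _. 0" "\<lambda>_. 0" "\<lambda>_. 0" x] by simp

lemma spline_sum:
  assumes "finite I"
  shows "spline (\<lambda>v r. \<Sum>i\<in>I. a i * cv i v r) (\<lambda>\<xi>. \<Sum>i\<in>I. a i * c i \<xi>) x =
    (\<Sum>i\<in>I. a i * spline (cv i) (c i) x)"
  using assms
proof (induction I rule: finite_induct)
  case empty
  then show ?case by (simp add: spline_zero)
next
  case (insert i I)
  then show ?case
    by (simp add: spline_linear[of "a i" "cv i" _ "c i"])
qed

text \<open>Finitely supported coefficients are linear combinations of Kronecker deltas, and the
  deltas define \<open>B_vertex\<close> and \<open>B0\<close>.\<close>

lemma spline_eq_sum_B_vertex_B0:
  assumes "finite X" "finite Y"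
    and cv: "\<And>v r. v \<notin> X \<Longrightarrow> cv v r = 0" and c: "\<And>\<xi>. \<xi> \<notin> Y \<Longrightarrow> c \<xi> = 0"
  shows "spline cv c x = (\<Sum>v\<in>X. \<Sum>r\<in>UNIV. cv v r * B_vertex v r x) + (\<Sum>\<xi>\<in>Y. c \<xi> * B0 \<xi> x)"
proof -
  have 1: "spline cv (\<lambda>_. 0) x = (\<Sum>(v, r)\<in>X \<times> UNIV. cv v r * B_vertex v r x)"
  proof -
    have "cv v' r' = (\<Sum>i\<in>X \<times> UNIV. cv (fst i) (snd i) * (if v' = fst i \<and> r' = snd i then 1 else 0))"
      for v' r'
    proof -
      have "(\<Sum>i\<in>X \<times> UNIV. cv (fst i) (snd i) * (if v' = fst i \<and> r' = snd i then 1 else 0)) =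
        (\<Sum>i\<in>X \<times> UNIV. if i = (v', r') then cv v' r' else 0)"
        by (intro sum.cong) auto
      then show ?thesis using assms by (simp add: sum.delta)
    qed
    then have "cv = (\<lambda>v' r'. \<Sum>i\<in>X \<times> UNIV. cv (fst i) (snd i) *
        (if v' = fst i \<and> r' = snd i then 1 else 0))"
      by blast
    \<comment> \<open>The vanishing second family is spelled as a sum of zeros to match
      \<open>spline_sum\<close>.\<close>
    then have "spline cv (\<lambda>_. 0) x = spline (\<lambda>v' r'. \<Sum>i\<in>X \<times> UNIV. cv (fst i) (snd i) *
        (if v' = fst i \<and> r' = snd i then 1 else 0)) (\<lambda>\<xi>. \<Sum>i\<in>X \<times> UNIV. cv (fst i) (snd i) * 0) x"
      by simp
    also have "\<dots> = (\<Sum>i\<in>X \<times> UNIV. cv (fst i) (snd i) * B_vertex (fst i) (snd i) x)"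
      unfolding B_vertex_def using assms(1) by (subst spline_sum) auto
    finally show ?thesis by (simp add: case_prod_unfold)
  qed
  have 2: "spline (\<lambda>_ _. 0) c x = (\<Sum>\<xi>\<in>Y. c \<xi> * B0 \<xi> x)"
  proof -
    have "c = (\<lambda>\<xi>'. \<Sum>\<xi>\<in>Y. c \<xi> * (if \<xi>' = \<xi> then 1 else 0))"
      using assms by (auto simp: fun_eq_iff if_distrib cong: if_cong)
    then have "spline (\<lambda>_ _. 0) c x =
        spline (\<lambda>v r. \<Sum>\<xi>\<in>Y. c \<xi> * 0) (\<lambda>\<xi>'. \<Sum>\<xi>\<in>Y. c \<xi> * (if \<xi>' = \<xi> then 1 else 0)) x"
      by simp
    also have "\<dots> = (\<Sum>\<xi>\<in>Y. c \<xi> * B0 \<xi> x)"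
      unfolding B0_def using assms(2) by (subst spline_sum) auto
    finally show ?thesis .
  qed
  have "spline cv c x = spline cv (\<lambda>_. 0) x + spline (\<lambda>_ _. 0) c x"
    using spline_linear[of 1 cv "\<lambda>_ _. 0" "\<lambda>_. 0" c x] by simp
  then show ?thesis
    unfolding 1 2 by (simp add: sum.cartesian_product)
qed

lemma span_combination:
  assumes "finite I" "\<And>i. i \<in> I \<Longrightarrow> F i \<in> real_fun.span S"
  shows "(\<lambda>x. \<Sum>i\<in>I. a i * F i x) \<in> real_fun.span S"
  using assms
proof (induction I rule: finite_induct)
  case empty
  then show ?case using real_fun.span_zero[of S] by (simp add: zero_fun_def)
next
  case (insert i I)
  have "(\<lambda>x. a i * F i x) + (\<lambda>x. \<Sum>i\<in>I. a i * F i x) \<in> real_fun.span S"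
    using insert by (intro real_fun.span_add real_fun.span_scale) auto
  then show ?case using insert by (simp add: plus_fun_def)
qed

end

section \<open>Powell-Sabin refinements\<close>

locale powell_sabin = cubic_ps +
  assumes finite_T: "finite T"
    and card_T_le: "t \<in> T \<Longrightarrow> finite t \<and> card t \<le> 3"
    and powell_sabin_points: powell_sabin_points
begin

lemma vt_interior: "t \<in> T \<Longrightarrow> vt t \<in> interior (convex hull t)"
  using powell_sabin_points unfolding powell_sabin_points_def by simp

text \<open>The hull of at most two points has empty interior in the plane, whereas
  \<open>vt t\<close> is an interior point.\<close>

lemma card_T: assumes "t \<in> T" shows "card t = 3"
proof (rule ccontr)
  assume "card t \<noteq> 3"
  then have "card t \<le> DIM(point)" using card_T_le[OF assms] by simp
  then show False
    using empty_interior_convex_hull card_T_le[OF assms] vt_interior[OF assms] by blast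
qed

lemma independent_T: assumes "t \<in> T" shows "\<not> affine_dependent t"
  using interior_convex_hull_eq_empty[of t] card_T[OF assms] vt_interior[OF assms] by auto

lemma finite_t: "t \<in> T \<Longrightarrow> finite t"
  using card_T_le by blast

lemma affine_hull_T: "t \<in> T \<Longrightarrow> affine hull t = UNIV"
  using affine_independent_span_eq[OF independent_T] card_T by simp

lemma edges_of_T:
  assumes "t \<in> T" "e \<in> edges_of t"
  shows "e \<in> E" "t \<in> attached e" "e \<subseteq> t" "card e = 2" "finite e"
  using assms finite_t finite_subset unfolding E_def attached_def edges_of_def by auto

lemma edgeE:
  assumes "e \<in> E"
  obtains v w t where "e = {v, w}" "v \<noteq> w" "t \<in> T" "t \<in> attached e" "e \<in> edges_of t"
proof -
  obtain t where "t \<in> T" "e \<in> edges_of t" using assms unfolding E_def by blast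
  moreover then obtain v w where "e = {v, w}" "v \<noteq> w"
    using edges_of_T(4) by (meson card_2_iff)
  ultimately show thesis using that edges_of_T by blast
qed

lemma attachedD:
  assumes "e \<in> E" "t \<in> attached e" shows "t \<in> T" "e \<in> edges_of t" "e \<subseteq> t"
  using assms unfolding attached_def by (auto elim!: edgeE simp: edges_of_def)

lemma finite_E: "finite E"
  unfolding E_def edges_of_def using finite_T finite_t by auto

lemma finite_V: "finite V"
  unfolding V_def using finite_T finite_t by auto

section \<open>Position of the split points relative to the edges\<close>

lemma vt_notin_affine_hull:
  assumes "t \<in> T" "e \<in> edges_of t"
  shows "vt t \<notin> affine hull e"
proof
  assume "vt t \<in> affine hull e"
  have e: "e \<subset> t" using assms card_T by (auto simp: edges_of_def)
  have "vt t \<in> rel_interior (convex hull t)"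
    using vt_interior[OF assms(1)] interior_subset_rel_interior by blast
  then obtain u where u: "\<forall>x\<in>t. 0 < u x" "sum u t = 1" "(\<Sum>x\<in>t. u x *\<^sub>R x) = vt t"
    unfolding rel_interior_convex_hull_explicit[OF independent_T[OF assms(1)]] by auto
  obtain u' where u': "sum u' e = 1" "(\<Sum>x\<in>e. u' x *\<^sub>R x) = vt t"
    using \<open>vt t \<in> affine hull e\<close> affine_hull_finite edges_of_T(5)[OF assms] by auto
  \<comment> \<open>The difference of two affine representations of \<open>vt t\<close>: one has
    positive weights on all of \<open>t\<close>, the other lives on \<open>e\<close>. It is nonzero
    at the vertex opposite to \<open>e\<close>.\<close>
  define w where "w x = u x - (if x \<in> e then u' x else 0)" for x
  have ft: "finite t" "t \<inter> e = e" using assms(1) finite_t e by auto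
  have "sum w t = 0"
    unfolding w_def sum_subtractf using u u' ft by (simp add: sum.If_cases)
  moreover have "(\<Sum>x\<in>t. w x *\<^sub>R x) = 0"
  proof -
    have "w x *\<^sub>R x = u x *\<^sub>R x - (if x \<in> e then u' x *\<^sub>R x else 0)" for x
      by (simp add: w_def scaleR_left_diff_distrib)
    then show ?thesis
      using u u' ft by (simp add: sum_subtractf sum.If_cases)
  qed
  moreover obtain z where "z \<in> t" "z \<notin> e" using e by blast
  then have "w z \<noteq> 0" using u by (auto simp: w_def)
  ultimately have "affine_dependent t"
    unfolding affine_dependent_explicit_finite[OF ft(1)] using \<open>z \<in> t\<close> by blast
  then show False using independent_T assms(1) by blast
qed

lemma ve_between:
  assumes "e \<in> E" "t \<in> attached e" "t' \<in> attached e" "t \<noteq> t'"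
  shows "ve e \<in> closed_segment (vt t) (vt t')" "ve e \<in> rel_interior (convex hull e)"
proof -
  have "closed_segment (vt t) (vt t') \<inter> rel_interior (convex hull e) = {ve e}"
    using powell_sabin_points assms unfolding powell_sabin_points_def by simp
  then show "ve e \<in> closed_segment (vt t) (vt t')" "ve e \<in> rel_interior (convex hull e)"
    by auto
qed

text \<open>A boundary edge is split at its midpoint; any other edge has a second attached triangle,
  and then \<open>ve e\<close> is the intersection point inside the edge.\<close>

lemma ve_rel_interior:
  assumes "e \<in> E" shows "ve e \<in> rel_interior (convex hull e)"
proof -
  obtain v w t where e: "e = {v, w}" "v \<noteq> w" "t \<in> attached e"
    using edgeE[OF assms] by metis
  show ?thesis
  proof (cases "boundary_edge e")
    case True
    then have "ve e = (1 / 2) *\<^sub>R (\<Sum>v\<in>e. v)"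
      using powell_sabin_points assms unfolding powell_sabin_points_def by simp
    then have "ve e = midpoint v w" using e by (simp add: midpoint_def scaleR_add_right)
    then show ?thesis
      using e by (simp add: rel_interior_closed_segment flip: segment_convex_hull)
  next
    case False
    then have "attached e \<noteq> {t}" using assms unfolding boundary_edge_def by auto
    then obtain t' where "t' \<in> attached e" "t \<noteq> t'" using e by blast
    then show ?thesis using ve_between assms e by blast
  qed
qed

lemma ve_in_affine_hull: "e \<in> E \<Longrightarrow> ve e \<in> affine hull e"
  using ve_rel_interior rel_interior_subset convex_hull_subset_affine_hull by blast

lemma ve_in_convex_hull: "e \<in> E \<Longrightarrow> ve e \<in> convex hull e"
  using ve_rel_interior rel_interior_subset by blast

lemma ve_neq_vertex:
  assumes "e \<in> E" "v \<in> e" shows "ve e \<noteq> v"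
proof -
  obtain a b t where e: "e = {a, b}" "a \<noteq> b" "t \<in> attached e"
    using edgeE[OF assms(1)] by metis
  then have "ve e \<in> open_segment a b"
    using ve_rel_interior[OF assms(1)]
    by (simp add: rel_interior_closed_segment flip: segment_convex_hull)
  then show ?thesis using e assms(2) by (auto simp: open_segment_def)
qed

lemma independent_edge:
  assumes "e \<in> E" shows "\<not> affine_dependent e"
proof -
  obtain v w t where e: "e = {v, w}"
    using edgeE[OF assms] by metis
  then show ?thesis by (simp add: affine_independent_2)
qed

text \<open>\<open>vt t\<close> is off the line through \<open>e\<close>, while \<open>v\<close> and
  \<open>ve e\<close> are distinct points on it.\<close>

lemma independent_small_triangle:
  assumes "t \<in> T" "e \<in> edges_of t" "v \<in> e"
  shows "\<not> affine_dependent {v, ve e, vt t}"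
    and "v \<noteq> ve e" "v \<noteq> vt t" "ve e \<noteq> vt t"
proof -
  have e: "e \<in> E" using edges_of_T assms by blast
  have n: "vt t \<notin> affine hull e" by (rule vt_notin_affine_hull[OF assms(1,2)])
  have "affine hull {v, ve e} \<subseteq> affine hull e"
    using assms(3) ve_in_affine_hull[OF e]
    by (intro hull_minimal) (auto simp: hull_inc)
  then have "\<not> affine_dependent (insert (vt t) {v, ve e})"
    using n by (intro affine_independent_insert affine_independent_2) auto
  then show "\<not> affine_dependent {v, ve e, vt t}" by (simp add: insert_commute)
  show "v \<noteq> ve e" using ve_neq_vertex[OF e assms(3)] by simp
  show "v \<noteq> vt t" using n assms(3) hull_inc by metis
  show "ve e \<noteq> vt t" using n ve_in_affine_hull[OF e] by metis
qed

text \<open>\<open>a\<close> and \<open>d\<close> describe the line through \<open>e\<close>. It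
  meets the segment between two split points in \<open>ve e\<close>, and the split points are off
  the line, so their signed offsets have opposite signs. The line is fixed before the triangles,
  which allows comparing more than two of them.\<close>

lemma vt_opposite_sides:
  assumes e: "e \<in> E"
  obtains a :: point and d where
    "\<And>t t'. t \<in> attached e \<Longrightarrow> t' \<in> attached e \<Longrightarrow> t \<noteq> t' \<Longrightarrow>
      (a \<bullet> vt t - d) * (a \<bullet> vt t' - d) < 0"
proof -
  obtain v w where vw: "e = {v, w}" "v \<noteq> w" using edgeE[OF e] by metis
  then have "aff_dim e = DIM(point) - 1" by simp
  then obtain a d where ad: "affine hull e = {x::point. a \<bullet> x = d}"
    using aff_dim_eq_hyperplane by blast
  show thesis
  proof
    fix t t' assume t: "t \<in> attached e" "t' \<in> attached e" "t \<noteq> t'"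
    then have n: "a \<bullet> vt t - d \<noteq> 0" "a \<bullet> vt t' - d \<noteq> 0"
      using vt_notin_affine_hull[OF attachedD(1,2)[OF e t(1)]]
        vt_notin_affine_hull[OF attachedD(1,2)[OF e t(2)]] ad by simp_all
    obtain u where u: "0 \<le> u" "u \<le> 1" "ve e = (1 - u) *\<^sub>R vt t + u *\<^sub>R vt t'"
      using ve_between[OF e t] by (auto simp: in_segment)
    have "a \<bullet> ve e = d" using ve_in_affine_hull[OF e] ad by simp
    \<comment> \<open>The offset of \<open>ve e\<close>, which is zero, is a convex combination of
      the offsets of the split points.\<close>
    then have z: "(1 - u) * (a \<bullet> vt t - d) + u * (a \<bullet> vt t' - d) = 0"
      unfolding u by (simp add: inner_add_right algebra_simps)
    show "(a \<bullet> vt t - d) * (a \<bullet> vt t' - d) < 0"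
    proof (rule ccontr)
      assume "\<not> ?thesis"
      then have "0 < (a \<bullet> vt t - d) * (a \<bullet> vt t' - d)" using n by (simp add: less_le)
      then consider "0 < a \<bullet> vt t - d" "0 < a \<bullet> vt t' - d" | "a \<bullet> vt t - d < 0" "a \<bullet> vt t' - d < 0"
        by (auto simp: zero_less_mult_iff)
      moreover have pos: "0 < (1 - u) * \<alpha> + u * \<beta>" if "0 < \<alpha>" "0 < \<beta>" for \<alpha> \<beta>
        using u(1,2) that by (cases "u = 0") (simp_all add: add_nonneg_pos)
      ultimately show False
      proof cases
        case 1
        then show False using pos[OF 1] z by simp
      next
        case 2
        then have "0 < (1 - u) * (d - a \<bullet> vt t) + u * (d - a \<bullet> vt t')"
          by (intro pos) simp_all
        then show False using z by (simp add: algebra_simps)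
      qed
    qed
  qed
qed

lemma vt_neq:
  assumes "e \<in> E" "t \<in> attached e" "t' \<in> attached e" "t \<noteq> t'"
  shows "vt t \<noteq> vt t'"
proof -
  obtain a d where "(a \<bullet> vt t - d) * (a \<bullet> vt t' - d) < 0"
    using vt_opposite_sides[OF assms(1)] assms(2-4) by metis
  then show ?thesis by (metis not_square_less_zero)
qed

text \<open>Three nonzero reals cannot have pairwise opposite signs, which excludes a third triangle
  at \<open>e\<close>.\<close>

lemma attached_at_most_two:
  assumes e: "e \<in> E" "t \<in> attached e" "t' \<in> attached e" "t \<noteq> t'"
  shows "attached e = {t, t'}"
proof -
  obtain a d where ad: "\<And>t t'. t \<in> attached e \<Longrightarrow> t' \<in> attached e \<Longrightarrow> t \<noteq> t' \<Longrightarrow>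
      (a \<bullet> vt t - d) * (a \<bullet> vt t' - d) < 0"
    using vt_opposite_sides[OF assms(1)] by metis
  have "s \<in> {t, t'}" if "s \<in> attached e" for s
  proof (rule ccontr)
    assume "s \<notin> {t, t'}"
    then show False using ad[of t t'] ad[of s t] ad[of s t'] e that
      by (auto simp: mult_less_0_iff)
  qed
  then show ?thesis using e by blast
qed

text \<open>Two successive exchanges: inserting \<open>vt t\<close> places \<open>x\<close> in a
  triangle over some edge \<open>e\<close>, and inserting \<open>ve e\<close> cuts that triangle in
  two.\<close>

lemma covered_small_triangles:
  assumes "x \<in> covered T"
  obtains v e t where "(v, e, t) \<in> small_triangles" "x \<in> convex hull {v, ve e, vt t}"
proof -
  obtain t where t: "t \<in> T" "x \<in> convex hull t"
    using assms unfolding covered_def by blast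
  have "vt t \<in> convex hull t" using vt_interior[OF t(1)] interior_subset by blast
  then obtain b where b: "b \<in> t" "x \<in> convex hull (insert (vt t) (t - {b}))"
    using t(2) convex_hull_exchange_Union by blast
  define e where "e = t - {b}"
  have e: "e \<in> edges_of t" using b card_T[OF t(1)] finite_t[OF t(1)] by (auto simp: e_def edges_of_def)
  then have E: "e \<in> E" using edges_of_T t by blast
  obtain v w where vw: "e = {v, w}" "v \<noteq> w" using edgeE[OF E] by metis
  have hull_e: "convex hull e = convex hull {ve e, w} \<union> convex hull {ve e, v}"
    using convex_hull_exchange_Union[OF ve_in_convex_hull[OF E]] vw by (auto simp: insert_Diff_if)
  have "ve e \<in> convex hull (insert (vt t) e)"
    using ve_in_convex_hull[OF E] hull_mono[of e "insert (vt t) e"] by blast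
  then obtain b' where b': "b' \<in> insert (vt t) e" "x \<in> convex hull (insert (ve e) (insert (vt t) e - {b'}))"
    using b(2) convex_hull_exchange_Union unfolding e_def by blast
  have "\<exists>v\<in>e. x \<in> convex hull {v, ve e, vt t}"
  proof (cases "b' \<in> e")
    case True
    then have "insert (ve e) (insert (vt t) e - {b'}) \<subseteq> {v, ve e, vt t} \<or>
        insert (ve e) (insert (vt t) e - {b'}) \<subseteq> {w, ve e, vt t}"
      using vw by blast
    then show ?thesis using b'(2) vw(1) hull_mono by blast
  next
    \<comment> \<open>The dropped point is \<open>vt t\<close>, so \<open>x\<close> lies on
      \<open>e\<close> itself, which \<open>ve e\<close> cuts into two segments.\<close>
    case False
    then have "insert (ve e) (insert (vt t) e - {b'}) \<subseteq> insert (ve e) e" using b' by blast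
    then have "x \<in> convex hull (insert (ve e) e)" using b'(2) hull_mono by blast
    also have "\<dots> = convex hull e"
      using ve_in_convex_hull[OF E] by (simp add: hull_redundant)
    finally have "x \<in> convex hull {ve e, w} \<or> x \<in> convex hull {ve e, v}"
      using hull_e by blast
    moreover have "convex hull {ve e, w} \<subseteq> convex hull {w, ve e, vt t}"
      "convex hull {ve e, v} \<subseteq> convex hull {v, ve e, vt t}"
      by (intro hull_mono; blast)+
    ultimately show ?thesis using vw(1) by blast
  qed
  then show thesis using that e t unfolding small_triangles_def by blast
qed

end

section \<open>The Bernstein-Bezier ordinates of a cubic polynomial\<close>

locale powell_sabin_blossom = powell_sabin +
  fixes P :: "point \<Rightarrow> point \<Rightarrow> point \<Rightarrow> real"
  assumes control_triangles: control_triangles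
    and blossom: "blossom P"
begin

text \<open>The argument is the point \<open>w\<close> with (2/3) v + (1/3) w =
  \<open>q v r\<close>, matching the point at which \<open>b_vvw\<close> evaluates \<open>L\<close>.
  Zero off \<open>V\<close> makes the support finite.\<close>

definition vertex_coeff :: "point \<Rightarrow> 3 \<Rightarrow> real" where
  "vertex_coeff v r = (if v \<in> V then P v v (3 *\<^sub>R q v r - 2 *\<^sub>R v) else 0)"

text \<open>For \<open>e = {v, w}\<close> this is \<open>P v w m\<close>, where \<open>m\<close> is the split point of \<open>\<tau>\<close>, respectively of \<open>e\<close>
  if \<open>\<tau>\<close> is empty.\<close>

definition edge_coeff :: "point set \<times> point set \<Rightarrow> real" where
  "edge_coeff = (\<lambda>(e, \<tau>). (1 / 2) * (\<Sum>v\<in>e. \<Sum>w\<in>e - {v}. P v w (if \<tau> = {} then ve e else vt \<tau>)))"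

text \<open>Both endpoints of an edge receive the same value. Zero outside the admissible triplets
  makes the support finite.\<close>

definition spline_coeff :: "point \<times> point set \<times> point set \<Rightarrow> real" where
  "spline_coeff = (\<lambda>(v, e, \<tau>). if (e, \<tau>) \<in> Xi1 \<and> v \<in> e then edge_coeff (e, \<tau>) else 0)"

lemma edge_coeff_eq:
  assumes "v \<noteq> w"
  shows "edge_coeff ({v, w}, \<tau>) = P v w (if \<tau> = {} then ve {v, w} else vt \<tau>)"
proof -
  have "{v, w} - {v} = {w}" "{v, w} - {w} = {v}" using assms by auto
  then show ?thesis
    using assms blossom_swap12[OF blossom, of w v] by (simp add: edge_coeff_def)
qed

text \<open>The empty set, which stands for the missing triangle at a boundary edge, cannot be
  confused with a triangle.\<close>

lemma empty_notin_T: "{} \<notin> T"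
  using card_T by fastforce

lemma spline_coeff_triangle:
  assumes "t \<in> T" "{v, w} \<in> edges_of t" "v \<noteq> w"
  shows "spline_coeff (v, {v, w}, t) = P v w (vt t)"
proof -
  have "({v, w}, t) \<in> Xi1" using edges_of_T[OF assms(1,2)] unfolding Xi1_def by simp
  moreover have "t \<noteq> {}" using assms empty_notin_T by blast
  ultimately show ?thesis using assms by (simp add: spline_coeff_def edge_coeff_eq)
qed

lemma spline_coeff_boundary:
  assumes "boundary_edge {v, w}" "v \<noteq> w"
  shows "spline_coeff (v, {v, w}, {}) = P v w (ve {v, w})"
proof -
  have "({v, w}, {}) \<in> Xi1" using assms unfolding Xi1_def boundary_edge_def by simp
  then show ?thesis using assms by (simp add: spline_coeff_def edge_coeff_eq)
qed

lemma other_endpoint: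
  assumes "e \<in> E" "v \<in> e"
  obtains w where "e = {v, w}" "v \<noteq> w"
  using assms by (auto elim!: edgeE)

section \<open>The ordinates as values of the blossom\<close>

lemma affine_fun_ve:
  assumes "affine_fun f" "e \<in> E"
  shows "(\<Sum>v\<in>e. bary e (ve e) v * f v) = f (ve e)"
  by (rule affine_fun_bary[OF assms(1) independent_edge[OF assms(2)] ve_in_affine_hull[OF assms(2)]])

lemma affine_fun_ve':
  assumes "affine_fun f" "{v, w} \<in> E" "v \<noteq> w"
  shows "bary {v, w} (ve {v, w}) v * f v + (1 - bary {v, w} (ve {v, w}) v) * f w = f (ve {v, w})"
proof -
  have "bary {v, w} (ve {v, w}) v + bary {v, w} (ve {v, w}) w = 1"
    using sum_bary[OF independent_edge[OF assms(2)] ve_in_affine_hull[OF assms(2)]] assms(3) by simp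
  then have "1 - bary {v, w} (ve {v, w}) v = bary {v, w} (ve {v, w}) w" by simp
  then show ?thesis using affine_fun_ve[OF assms(1,2)] assms(3) by simp
qed

lemma affine_fun_vt:
  assumes "affine_fun f" "t \<in> T"
  shows "(\<Sum>v\<in>t. bary t (vt t) v * f v) = f (vt t)"
  using affine_hull_T[OF assms(2)]
  by (intro affine_fun_bary[OF assms(1) independent_T[OF assms(2)]]) simp

text \<open>\<open>?f\<close> is affine with the values \<open>vertex_coeff v r\<close> at the
  vertices of the control triangle, so it agrees with \<open>L\<close>; at \<open>?x\<close> the
  rescaled argument is \<open>w\<close>.\<close>

lemma b_vvw_blossom:
  assumes "v \<in> V"
  shows "b_vvw vertex_coeff v w = P v v w"
proof -
  let ?S = "range (q v)" and ?x = "(2 / 3) *\<^sub>R v + (1 / 3) *\<^sub>R w"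
  let ?f = "\<lambda>x. P v v (3 *\<^sub>R x + (- 2) *\<^sub>R v)"
  have S: "inj (q v)" "\<not> affine_dependent ?S"
    using control_triangles assms unfolding control_triangles_def by simp_all
  then have "card ?S = Suc (DIM(point))" by (simp add: card_image)
  then have "?x \<in> affine hull ?S"
    using affine_independent_span_eq[OF S(2)] by simp
  moreover have "affine_fun ?f"
    by (rule affine_fun_rescale[OF blossom_affine3[OF blossom]])
  ultimately have "(\<Sum>y\<in>?S. bary ?S ?x y * ?f y) = ?f ?x"
    using S(2) by (intro affine_fun_bary)
  moreover have "(\<Sum>y\<in>?S. bary ?S ?x y * ?f y) = (\<Sum>r\<in>UNIV. bary ?S ?x (q v r) * ?f (q v r))"
    using S(1) by (simp add: sum.reindex)
  moreover have "?f ?x = P v v w" by (simp add: scaleR_add_right)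
  ultimately show ?thesis
    unfolding b_vvw_def L_def vertex_coeff_def using assms by (simp add: mult.commute)
qed

lemma b_vet_blossom:
  assumes "t \<in> T" "e \<in> edges_of t" "v \<in> e"
  shows "b_vet vertex_coeff spline_coeff v e t = P v (ve e) (vt t)"
proof -
  have e: "e \<in> E" "v \<in> V" using assms edges_of_T unfolding V_def by blast+
  obtain w where w: "e = {v, w}" "v \<noteq> w" using other_endpoint[OF e(1) assms(3)] by blast
  show ?thesis
    using affine_fun_ve'[OF blossom_affine2[OF blossom, of v "vt t"]] e assms w
    by (simp add: b_vet_def b_vvw_blossom spline_coeff_triangle)
qed

text \<open>On a boundary edge this is affinity in the second argument along \<open>e\<close>; on an
  inner edge it is affinity in the third argument along the segment between the two split
  points.\<close>

lemma b_vee_blossom: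
  assumes e: "e \<in> E" and v: "v \<in> e"
  shows "b_vee vertex_coeff spline_coeff v e = P v (ve e) (ve e)"
proof -
  obtain w where w: "e = {v, w}" "v \<noteq> w" using other_endpoint[OF assms] by blast
  obtain t where t: "t \<in> T" "t \<in> attached e" "e \<in> edges_of t" using edgeE[OF e] by blast
  have vV: "v \<in> V" using v t edges_of_T unfolding V_def by blast
  show ?thesis
  proof (cases "boundary_edge e")
    case True
    then show ?thesis
      using affine_fun_ve'[OF blossom_affine2[OF blossom, of v "ve e"]] e vV w
      by (simp add: b_vee_def b_vvw_blossom spline_coeff_boundary)
  next
    case False
    then have "attached e \<noteq> {t}" using e unfolding boundary_edge_def by auto
    then obtain t' where t': "t' \<in> attached e" "t \<noteq> t'" using t by blast
    have at: "attached e = {t, t'}"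
      using attached_at_most_two[OF e t(2) t'] .
    let ?S = "{vt t, vt t'}"
    have ne: "vt t \<noteq> vt t'" using vt_neq[OF e t(2) t'] .
    have "ve e \<in> convex hull ?S"
      using ve_between[OF e t(2) t'] by (simp add: segment_convex_hull)
    then have "ve e \<in> affine hull ?S" using convex_hull_subset_affine_hull by blast
    then have "(\<Sum>y\<in>?S. bary ?S (ve e) y * P v (ve e) y) = P v (ve e) (ve e)"
      by (intro affine_fun_bary blossom_affine3[OF blossom] affine_independent_2)
    moreover have "t' \<in> T" "e \<in> edges_of t'" using attachedD[OF e t'(1)] by auto
    ultimately show ?thesis
      using False at ne t t' v by (simp add: b_vee_def b_vet_blossom)
  qed
qed

lemma b_eee_blossom:
  assumes "e \<in> E"
  shows "b_eee vertex_coeff spline_coeff e = P (ve e) (ve e) (ve e)"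
  using affine_fun_ve[OF blossom_affine1[OF blossom] assms]
  by (simp add: b_eee_def b_vee_blossom[OF assms])

lemma b_eet_blossom:
  assumes "t \<in> T" "e \<in> edges_of t"
  shows "b_eet vertex_coeff spline_coeff e t = P (ve e) (ve e) (vt t)"
  using affine_fun_ve[OF blossom_affine1[OF blossom]] edges_of_T[OF assms]
  by (simp add: b_eet_def b_vet_blossom[OF assms])

text \<open>The second argument \<open>vt t\<close> is expanded over the vertices of
  \<open>t\<close>: the term at \<open>v\<close> is a vertex ordinate, the others are edge
  coefficients.\<close>

lemma b_vtt_blossom:
  assumes "t \<in> T" "v \<in> t"
  shows "b_vtt vertex_coeff spline_coeff v t = P v (vt t) (vt t)"
proof -
  have "(\<Sum>w\<in>t - {v}. bary t (vt t) w * spline_coeff (v, {v, w}, t)) =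
      (\<Sum>w\<in>t - {v}. bary t (vt t) w * P v w (vt t))"
  proof (intro sum.cong refl)
    fix w assume w: "w \<in> t - {v}"
    then have "{v, w} \<in> edges_of t" using assms by (auto simp: edges_of_def)
    then show "bary t (vt t) w * spline_coeff (v, {v, w}, t) = bary t (vt t) w * P v w (vt t)"
      using spline_coeff_triangle[OF assms(1)] w by auto
  qed
  moreover have "v \<in> V" using assms unfolding V_def by blast
  moreover have "(\<Sum>w\<in>t. bary t (vt t) w * P v w (vt t)) = P v (vt t) (vt t)"
    using affine_fun_vt[OF blossom_affine2[OF blossom] assms(1)] .
  moreover have "(\<Sum>w\<in>t. bary t (vt t) w * P v w (vt t)) =
      bary t (vt t) v * P v v (vt t) + (\<Sum>w\<in>t - {v}. bary t (vt t) w * P v w (vt t))"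
    using finite_t[OF assms(1)] assms(2) by (rule sum.remove)
  ultimately show ?thesis
    unfolding b_vtt_def by (simp add: b_vvw_blossom)
qed

lemma b_ett_blossom:
  assumes "t \<in> T" "e \<in> edges_of t"
  shows "b_ett vertex_coeff spline_coeff e t = P (ve e) (vt t) (vt t)"
proof -
  have "(\<Sum>v\<in>e. bary e (ve e) v * b_vtt vertex_coeff spline_coeff v t) =
      (\<Sum>v\<in>e. bary e (ve e) v * P v (vt t) (vt t))"
    using b_vtt_blossom[OF assms(1)] edges_of_T(3)[OF assms] by (intro sum.cong) auto
  then show ?thesis
    using affine_fun_ve[OF blossom_affine1[OF blossom]] edges_of_T(1)[OF assms]
    by (simp add: b_ett_def)
qed

lemma b_ttt_blossom:
  assumes "t \<in> T"
  shows "b_ttt vertex_coeff spline_coeff t = P (vt t) (vt t) (vt t)"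
  using affine_fun_vt[OF blossom_affine1[OF blossom] assms]
  by (simp add: b_ttt_def b_vtt_blossom[OF assms])

lemma piece_blossom:
  assumes "s \<in> small_triangles"
  shows "piece vertex_coeff spline_coeff s x = P x x x"
proof -
  obtain v e t where s: "s = (v, e, t)" and t: "t \<in> T" "e \<in> edges_of t" "v \<in> e"
    using assms unfolding small_triangles_def by auto
  note e = edges_of_T[OF t(1,2)]
  have v: "v \<in> V" "v \<in> t" using e t unfolding V_def by blast+
  note ind = independent_small_triangle[OF t]
  let ?S = "{v, ve e, vt t}"
  have "card ?S = Suc (DIM(point))" using ind by simp
  then have x: "x \<in> affine hull ?S" using affine_independent_span_eq[OF ind(1)] by simp
  have 1: "bary ?S x v + bary ?S x (ve e) + bary ?S x (vt t) = 1"
    using sum_bary[OF ind(1) x] ind(2-4) by simp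
  have 2: "bary ?S x v *\<^sub>R v + bary ?S x (ve e) *\<^sub>R ve e + bary ?S x (vt t) *\<^sub>R vt t = x"
    using sum_bary_scaleR[OF ind(1) x] ind(2-4) by (simp add: add.assoc)
  show ?thesis
    unfolding blossom_expand[OF blossom 1 2[symmetric]] s
    by (simp add: piece_def Let_def b_vvw_blossom[OF v(1)] b_vet_blossom[OF t]
        b_vee_blossom[OF e(1) t(3)] b_eee_blossom[OF e(1)] b_eet_blossom[OF t(1,2)]
        b_vtt_blossom[OF t(1) v(2)] b_ett_blossom[OF t(1,2)] b_ttt_blossom[OF t(1)])
qed

text \<open>Every small triangle carries the same polynomial, so whichever one is selected yields
  \<open>P x x x\<close>.\<close>

lemma spline_blossom:
  "spline vertex_coeff spline_coeff x = (if x \<in> covered T then P x x x else 0)"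
proof (cases "x \<in> covered T")
  case True
  let ?Q = "\<lambda>(v, e, t). (v, e, t) \<in> small_triangles \<and> x \<in> convex hull {v, ve e, vt t}"
  obtain v e t where "(v, e, t) \<in> small_triangles" "x \<in> convex hull {v, ve e, vt t}"
    using covered_small_triangles[OF True] .
  then have "?Q (v, e, t)" by simp
  then have "?Q (SOME s. ?Q s)" by (rule someI)
  then have "(SOME s. ?Q s) \<in> small_triangles" by (auto simp: case_prod_unfold)
  then show ?thesis using True by (simp add: spline_def piece_blossom)
qed (simp add: spline_def)

section \<open>The two reductions\<close>

lemma finite_Xi1: "finite Xi1"
proof (rule finite_subset)
  show "Xi1 \<subseteq> E \<times> insert {} T" unfolding Xi1_def attached_def by auto
qed (simp add: finite_E finite_T)

lemma Xi1_edge: "(e, \<tau>) \<in> Xi1 \<Longrightarrow> e \<in> E"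
  unfolding Xi1_def by simp

lemma finite_edge: "e \<in> E \<Longrightarrow> finite e"
  by (auto elim: edgeE)

text \<open>The coefficients at the two endpoints of an edge agree, so the \<open>B0\<close> terms
  of each pair add up to one \<open>B1\<close> term.\<close>

lemma spline_first_reduction:
  "spline vertex_coeff spline_coeff x =
    (\<Sum>v\<in>V. \<Sum>r\<in>UNIV. vertex_coeff v r * B_vertex v r x) + (\<Sum>\<eta>\<in>Xi1. edge_coeff \<eta> * B1 \<eta> x)"
proof -
  \<comment> \<open>The admissible triplets, parametrised by pair and endpoint so that the sum can
    be grouped by pairs.\<close>
  define Y where "Y = (\<lambda>(\<eta>, v). (v, fst \<eta>, snd \<eta>)) ` (SIGMA \<eta>:Xi1. fst \<eta>)"
  have fin: "\<forall>\<eta>\<in>Xi1. finite (fst \<eta>)" using Xi1_edge finite_edge by auto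
  have inj: "inj_on (\<lambda>(\<eta>, v). (v, fst \<eta>, snd \<eta>)) (SIGMA \<eta>:Xi1. fst \<eta>)"
    by (auto simp: inj_on_def)
  have "spline vertex_coeff spline_coeff x =
      (\<Sum>v\<in>V. \<Sum>r\<in>UNIV. vertex_coeff v r * B_vertex v r x) + (\<Sum>\<xi>\<in>Y. spline_coeff \<xi> * B0 \<xi> x)"
  proof (rule spline_eq_sum_B_vertex_B0)
    show "finite Y" unfolding Y_def using fin finite_Xi1 by auto
    show "spline_coeff \<xi> = 0" if "\<xi> \<notin> Y" for \<xi>
    proof -
      obtain v e \<tau> where \<xi>: "\<xi> = (v, e, \<tau>)" by (metis prod_cases3)
      have "\<not> ((e, \<tau>) \<in> Xi1 \<and> v \<in> e)"
      proof
        assume "(e, \<tau>) \<in> Xi1 \<and> v \<in> e"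
        then have "((e, \<tau>), v) \<in> (SIGMA \<eta>:Xi1. fst \<eta>)" by simp
        then have "(v, e, \<tau>) \<in> Y" unfolding Y_def by force
        then show False using that \<xi> by simp
      qed
      then show ?thesis unfolding \<xi> spline_coeff_def by auto
    qed
  qed (auto simp: finite_V vertex_coeff_def)
  also have "(\<Sum>\<xi>\<in>Y. spline_coeff \<xi> * B0 \<xi> x) =
      (\<Sum>(\<eta>, v)\<in>(SIGMA \<eta>:Xi1. fst \<eta>). edge_coeff \<eta> * B0 (v, fst \<eta>, snd \<eta>) x)"
    unfolding Y_def sum.reindex[OF inj]
    by (intro sum.cong) (auto simp: spline_coeff_def)
  also have "\<dots> = (\<Sum>\<eta>\<in>Xi1. \<Sum>v\<in>fst \<eta>. edge_coeff \<eta> * B0 (v, fst \<eta>, snd \<eta>) x)"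
    using finite_Xi1 fin by (subst sum.Sigma) auto
  also have "\<dots> = (\<Sum>\<eta>\<in>Xi1. edge_coeff \<eta> * B1 \<eta> x)"
    by (intro sum.cong) (auto simp: B1_def sum_distrib_left)
  finally show ?thesis .
qed

section \<open>Pairs at symmetric triangles and the second reduction\<close>

definition near_sym :: "(point set \<times> point set) set" where
  "near_sym = {(e, \<tau>) \<in> Xi1. \<exists>t\<in>T_sym. t \<in> attached e}"

text \<open>The symmetric configuration is invariant under cyclic relabelling, so any edge may play
  the role of the first one.\<close>

lemma T_sym_edge:
  assumes "t \<in> T_sym" "e \<in> edges_of t"
  obtains v w z where "v \<noteq> w" "e = {v, w}" "t = {v, w, z}" "{v, w, v + w - z} \<in> neighbours t"
    "vt t = barycenter t" "vt {v, w, v + w - z} = barycenter {v, w, v + w - z}"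
proof -
  obtain v1 v2 v3 where t: "t \<in> T" "t = {v1, v2, v3}"
    and nb: "neighbours t = {{v1, v2, v1 + v2 - v3}, {v2, v3, v2 + v3 - v1}, {v3, v1, v3 + v1 - v2}}"
    and bc: "\<forall>t'\<in>insert t (neighbours t). vt t' = barycenter t'"
    using assms(1) unfolding T_sym_def by blast
  have "v1 \<noteq> v2" "v2 \<noteq> v3" "v3 \<noteq> v1" using card_T[OF t(1)] t(2) by (auto simp: card_insert_if split: if_splits)
  moreover have "e = {v1, v2} \<or> e = {v2, v3} \<or> e = {v3, v1}"
    using assms(2) unfolding t(2) edges_of_def by (auto simp: card_2_iff doubleton_eq_iff)
  moreover have "t = {v2, v3, v1}" "t = {v3, v1, v2}" using t(2) by auto
  ultimately show thesis
    using that[of v1 v2 v3] that[of v2 v3 v1] that[of v3 v1 v2] t(2) nb bc by auto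
qed

lemma neighbour_attached:
  assumes "t \<in> T_sym" "e \<in> edges_of t"
  obtains t' where "attached e = {t, t'}" "t' \<noteq> t" "\<not> boundary_edge e"
proof -
  have t: "t \<in> T" using assms(1) unfolding T_sym_def by simp
  obtain v w z where e: "e = {v, w}" "{v, w, v + w - z} \<in> neighbours t"
    using T_sym_edge[OF assms] by metis
  let ?t' = "{v, w, v + w - z}"
  have t': "?t' \<in> attached e" "?t' \<noteq> t" using e unfolding neighbours_def attached_def by auto
  have at: "attached e = {t, ?t'}"
    using attached_at_most_two[of e t ?t'] edges_of_T[OF t assms(2)] t' by auto
  then have "\<not> boundary_edge e" using t'(2) unfolding boundary_edge_def by auto
  then show thesis using that t' at by blast
qed

lemma other_eq:
  assumes "attached e = {t, t'}" "t \<noteq> t'" shows "other e t = t'"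
  unfolding other_def using assms by (intro the_equality) auto

text \<open>With \<open>z\<close> opposite to \<open>e = {v, w}\<close>, the two split points are (v
  + w + z) / 3 and (2 v + 2 w - z) / 3. Twice the first minus the second is \<open>z\<close>, so
  affinity of \<open>P v w\<close> gives \<open>P v w z\<close>.\<close>

lemma sym_edge_coeff:
  assumes "t \<in> T_sym" "t = {a, b, c}" "e \<in> edges_of t"
  shows "2 * edge_coeff (e, t) - edge_coeff (e, other e t) = P a b c"
proof -
  have t: "t \<in> T" using assms(1) unfolding T_sym_def by simp
  obtain v w z where vw: "v \<noteq> w" "e = {v, w}" "t = {v, w, z}" "{v, w, v + w - z} \<in> neighbours t"
    "vt t = barycenter t" "vt {v, w, v + w - z} = barycenter {v, w, v + w - z}"
    using T_sym_edge[OF assms(1,3)] .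
  let ?t' = "{v, w, v + w - z}"
  have t': "?t' \<in> T" "?t' \<noteq> t" "?t' \<in> attached e" using vw unfolding neighbours_def attached_def by auto
  have d: "v \<noteq> z" "w \<noteq> z" using card_T[OF t] vw(1,3) by (auto simp: card_insert_if split: if_splits)
  have d': "v \<noteq> v + w - z" "w \<noteq> v + w - z" using card_T[OF t'(1)] vw(1) by (auto simp: card_insert_if split: if_splits)
  have "other e t = ?t'"
    using attached_at_most_two[of e t ?t'] edges_of_T[OF t assms(3)] t'
    by (intro other_eq) auto
  moreover have "vt t = (1 / 3) *\<^sub>R v + (1 / 3) *\<^sub>R w + (1 / 3) *\<^sub>R z"
    unfolding vw(5) unfolding vw(3) barycenter_def
    using vw(1) d by (simp add: scaleR_add_right add.assoc)
  then have "P v w (vt t) = 1 / 3 * P v w v + 1 / 3 * P v w w + 1 / 3 * P v w z"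
    using affine_fun_combination3[OF blossom_affine3[OF blossom, of v w], of "1/3" "1/3" "1/3" v w z]
    by simp
  moreover have "vt ?t' = (2 / 3) *\<^sub>R v + (2 / 3) *\<^sub>R w + (- 1 / 3) *\<^sub>R z"
    unfolding vw(6) barycenter_def using vw(1) d'
    by (simp add: vec_eq_iff field_simps)
  then have "P v w (vt ?t') = 2 / 3 * P v w v + 2 / 3 * P v w w + (- 1 / 3) * P v w z"
    using affine_fun_combination3[OF blossom_affine3[OF blossom, of v w], of "2/3" "2/3" "-1/3" v w z]
    by simp
  ultimately have *: "2 * edge_coeff (e, t) - edge_coeff (e, other e t) = P v w z"
    using vw(1,2) t t' empty_notin_T by (auto simp: edge_coeff_eq)
  \<comment> \<open>The triples are permutations of each other, and symmetry of \<open>P\<close>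
    removes the dependence on \<open>e\<close>.\<close>
  have "v \<in> {a, b, c}" "w \<in> {a, b, c}" "z \<in> {a, b, c}"
    using vw(3) assms(2) by blast+
  then have "P v w z = P a b c"
    using vw(1) d
    by (elim insertE emptyE)
      (simp_all add: blossom_swap12[OF blossom] blossom_swap23[OF blossom])
  then show ?thesis using * by simp
qed

text \<open>An edge of a symmetric triangle is an inner edge with exactly two attached triangles, so
  \<open>other e\<close> swaps its two pairs.\<close>

lemma near_sym_other:
  assumes "(e, \<tau>) \<in> near_sym"
  shows "(e, other e \<tau>) \<in> near_sym" "other e (other e \<tau>) = \<tau>"
proof -
  obtain t where t: "t \<in> T_sym" "t \<in> attached e" and Xi1: "(e, \<tau>) \<in> Xi1"
    using assms unfolding near_sym_def by auto
  have e: "e \<in> edges_of t" using attachedD[OF Xi1_edge[OF Xi1] t(2)] by simp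
  obtain t' where t': "attached e = {t, t'}" "t' \<noteq> t" "\<not> boundary_edge e"
    using neighbour_attached[OF t(1) e] by metis
  then have "\<tau> = t \<or> \<tau> = t'" using Xi1 unfolding Xi1_def by auto
  moreover have "other e t = t'" "other e t' = t"
    using other_eq[of e t t'] other_eq[of e t' t] t' by auto
  moreover have "(e, t) \<in> near_sym" "(e, t') \<in> near_sym"
    using Xi1_edge[OF Xi1] t t' unfolding near_sym_def Xi1_def by auto
  ultimately show "(e, other e \<tau>) \<in> near_sym" "other e (other e \<tau>) = \<tau>"
    using t' by auto
qed

text \<open>Chosen so that on \<open>near_sym\<close> each edge coefficient is 2/3 of its own
  reduced coefficient plus 1/3 of its partner's.\<close>

definition reduced_coeff :: "point set \<times> point set \<Rightarrow> real" where
  "reduced_coeff = (\<lambda>(e, \<tau>). if (e, \<tau>) \<in> near_sym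
     then 2 * edge_coeff (e, \<tau>) - edge_coeff (e, other e \<tau>) else edge_coeff (e, \<tau>))"

text \<open>The averaging of the second reduction on all of \<open>Xi1\<close>, including pairs with
  symmetric \<tau>; the three functions of such a triangle are merged later.\<close>

definition reduced_B1 :: "point set \<times> point set \<Rightarrow> point \<Rightarrow> real" where
  "reduced_B1 = (\<lambda>(e, \<tau>) x. if (e, \<tau>) \<in> near_sym
     then 2 / 3 * B1 (e, \<tau>) x + 1 / 3 * B1 (e, other e \<tau>) x else B1 (e, \<tau>) x)"

text \<open>Since \<open>other e\<close> is an involution, reindexing the part with weight 1/3 moves
  the averaging from the coefficients to the functions.\<close>

lemma sum_reduced_B1:
  "(\<Sum>\<eta>\<in>Xi1. edge_coeff \<eta> * B1 \<eta> x) = (\<Sum>\<eta>\<in>Xi1. reduced_coeff \<eta> * reduced_B1 \<eta> x)"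
proof -
  let ?o = "\<lambda>(e, \<tau>). (e, other e \<tau>)"
  have sub: "near_sym \<subseteq> Xi1" unfolding near_sym_def by auto
  note fin = finite_Xi1 finite_subset[OF sub finite_Xi1]
  have split: "sum f Xi1 = sum f near_sym + sum f (Xi1 - near_sym)" for f :: "_ \<Rightarrow> real"
    using sum.subset_diff[OF sub fin(1), of f] by simp
  have flip: "(\<Sum>\<eta>\<in>near_sym. f (?o \<eta>)) = sum f near_sym" for f :: "_ \<Rightarrow> real"
    by (rule sum.reindex_bij_witness[of _ ?o ?o]) (auto simp: near_sym_other)
  have coeff: "edge_coeff \<eta> = 2 / 3 * reduced_coeff \<eta> + 1 / 3 * reduced_coeff (?o \<eta>)"
    if "\<eta> \<in> near_sym" for \<eta>
    using that by (cases \<eta>) (simp add: reduced_coeff_def near_sym_other(1,2) field_simps)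
  have "(\<Sum>\<eta>\<in>near_sym. edge_coeff \<eta> * B1 \<eta> x) =
      2 / 3 * (\<Sum>\<eta>\<in>near_sym. reduced_coeff \<eta> * B1 \<eta> x) +
      1 / 3 * (\<Sum>\<eta>\<in>near_sym. reduced_coeff (?o \<eta>) * B1 \<eta> x)"
    by (simp add: coeff distrib_right sum.distrib sum_distrib_left mult.assoc)
  also have "(\<Sum>\<eta>\<in>near_sym. reduced_coeff (?o \<eta>) * B1 \<eta> x) =
      (\<Sum>\<eta>\<in>near_sym. reduced_coeff (?o (?o \<eta>)) * B1 (?o \<eta>) x)"
    by (rule flip[symmetric])
  also have "\<dots> = (\<Sum>\<eta>\<in>near_sym. reduced_coeff \<eta> * B1 (?o \<eta>) x)"
    by (intro sum.cong refl) (auto simp: near_sym_other)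
  also have "2 / 3 * (\<Sum>\<eta>\<in>near_sym. reduced_coeff \<eta> * B1 \<eta> x) +
      1 / 3 * (\<Sum>\<eta>\<in>near_sym. reduced_coeff \<eta> * B1 (?o \<eta>) x) =
      (\<Sum>\<eta>\<in>near_sym. reduced_coeff \<eta> * reduced_B1 \<eta> x)"
    unfolding sum_distrib_left sum.distrib[symmetric]
    by (intro sum.cong refl) (auto simp: reduced_B1_def algebra_simps)
  finally show ?thesis
    unfolding split[of "\<lambda>\<eta>. edge_coeff \<eta> * B1 \<eta> x"] split[of "\<lambda>\<eta>. reduced_coeff \<eta> * reduced_B1 \<eta> x"]
    by (auto simp: reduced_coeff_def reduced_B1_def case_prod_unfold intro!: sum.cong)
qed

lemma near_sym_T_sym:
  assumes "t \<in> T_sym" "e \<in> edges_of t"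
  shows "(e, t) \<in> near_sym"
proof -
  have "t \<in> T" using assms(1) unfolding T_sym_def by simp
  then show ?thesis
    using edges_of_T[OF _ assms(2)] assms(1) unfolding near_sym_def Xi1_def by auto
qed

text \<open>Equality over the three edges lets a single coefficient serve
  \<open>B2 ({}, t)\<close>.\<close>

lemma reduced_coeff_T_sym:
  assumes t: "t \<in> T_sym"
  shows "\<exists>g. \<forall>e\<in>edges_of t. reduced_coeff (e, t) = g"
proof -
  have "t \<in> T" using t unfolding T_sym_def by simp
  then obtain a b c where abc: "t = {a, b, c}" using card_T by (meson card_3_iff)
  have "reduced_coeff (e, t) = P a b c" if "e \<in> edges_of t" for e
    using sym_edge_coeff[OF t abc that] near_sym_T_sym[OF t that] by (simp add: reduced_coeff_def)
  then show ?thesis by blast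
qed

text \<open>As \<tau> is not symmetric, any symmetric triangle at \<open>e\<close> differs from it,
  so the case distinction in \<open>B2\<close> is membership in \<open>near_sym\<close>.\<close>

lemma B2_eq_reduced_B1:
  assumes "(e, \<tau>) \<in> Xi1" "\<tau> \<notin> T_sym"
  shows "B2 (e, \<tau>) = reduced_B1 (e, \<tau>)"
proof -
  have "e \<noteq> {}" using edgeE[OF Xi1_edge[OF assms(1)]] by auto
  moreover have "(\<exists>t\<in>T_sym. t \<in> attached e \<and> t \<noteq> \<tau>) \<longleftrightarrow> (e, \<tau>) \<in> near_sym"
    using assms unfolding near_sym_def by auto
  ultimately show ?thesis unfolding B2_def reduced_B1_def by auto
qed

lemma second_reduction_in_S2:
  "(\<lambda>x. \<Sum>\<eta>\<in>Xi1. edge_coeff \<eta> * B1 \<eta> x) \<in> S2"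
proof -
  \<comment> \<open>\<open>?N\<close> holds the pairs kept in \<open>Xi2\<close>. The remaining ones
    are indexed by \<open>?M\<close> with the triangle first, to be summed over the edges of each
    symmetric triangle.\<close>
  let ?N = "{(e, \<tau>) \<in> Xi1. \<tau> \<notin> T_sym}" and ?M = "SIGMA t:T_sym. edges_of t"
  have TT: "T_sym \<subseteq> T" unfolding T_sym_def by auto
  have finE: "finite (edges_of t)" if "t \<in> T" for t
    using finite_t[OF that] unfolding edges_of_def by simp
  have fin: "finite T_sym" "\<forall>t\<in>T_sym. finite (edges_of t)" "finite ?N"
    using finite_subset[OF TT finite_T] finE TT finite_subset[OF _ finite_Xi1, of ?N] by auto
  obtain g where g: "\<And>t e. t \<in> T_sym \<Longrightarrow> e \<in> edges_of t \<Longrightarrow> reduced_coeff (e, t) = g t"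
    using reduced_coeff_T_sym by metis
  \<comment> \<open>The common coefficient factors out, and the three averaged edge functions add up
    to \<open>B2 ({}, t)\<close>.\<close>
  have "(\<Sum>e\<in>edges_of t. reduced_coeff (e, t) * reduced_B1 (e, t) x) = g t * B2 ({}, t) x"
    if t: "t \<in> T_sym" for t x
    using t unfolding B2_def by (simp add: sum_distrib_left g reduced_B1_def near_sym_T_sym)
  moreover have "(\<Sum>\<eta>\<in>Xi1 - ?N. f \<eta>) = (\<Sum>t\<in>T_sym. \<Sum>e\<in>edges_of t. f (e, t))"
    for f :: "_ \<Rightarrow> real"
  proof -
    have "(\<Sum>\<eta>\<in>Xi1 - ?N. f \<eta>) = (\<Sum>(t, e)\<in>?M. f (e, t))"
    proof (rule sum.reindex_bij_witness[of _ "\<lambda>(t, e). (e, t)" "\<lambda>(e, t). (t, e)"])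
      fix \<eta> assume "\<eta> \<in> Xi1 - ?N"
      then obtain e t where \<eta>: "\<eta> = (e, t)" "(e, t) \<in> Xi1" "t \<in> T_sym" by auto
      then have "t \<in> attached e" "e \<in> E" using TT empty_notin_T unfolding Xi1_def by auto
      then show "(case \<eta> of (e, t) \<Rightarrow> (t, e)) \<in> ?M" using \<eta> attachedD by auto
    qed (use TT edges_of_T in \<open>auto simp: Xi1_def\<close>)
    then show ?thesis using fin by (simp add: sum.Sigma)
  qed
  moreover have "sum f Xi1 = sum f (Xi1 - ?N) + sum f ?N" for f :: "_ \<Rightarrow> real"
    using finite_Xi1 by (intro sum.subset_diff) auto
  moreover have "(\<Sum>\<eta>\<in>?N. reduced_coeff \<eta> * reduced_B1 \<eta> x) = (\<Sum>\<eta>\<in>?N. reduced_coeff \<eta> * B2 \<eta> x)"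
    for x
    by (intro sum.cong refl) (auto simp: B2_eq_reduced_B1)
  ultimately have "(\<lambda>x. \<Sum>\<eta>\<in>Xi1. edge_coeff \<eta> * B1 \<eta> x) =
      (\<lambda>x. \<Sum>t\<in>T_sym. g t * B2 ({}, t) x) + (\<lambda>x. \<Sum>\<eta>\<in>?N. reduced_coeff \<eta> * B2 \<eta> x)"
    unfolding sum_reduced_B1 plus_fun_def
    by simp
  also have "\<dots> \<in> S2"
    unfolding S2_def using fin
    by (intro real_fun.span_add span_combination real_fun.span_base)
      (auto simp: Xi2_def)
  finally show ?thesis .
qed

section \<open>Cubic polynomials in the reduced space\<close>

lemma blossom_diagonal_in_S2: "(\<lambda>x. if x \<in> covered T then P x x x else 0) \<in> S2"
proof -
  have "(\<lambda>x. \<Sum>v\<in>V. 1 * (\<Sum>r\<in>UNIV. vertex_coeff v r * B_vertex v r x)) \<in> S2"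
    unfolding S2_def using finite_V
    by (intro span_combination real_fun.span_base) auto
  then have "(\<lambda>x. \<Sum>v\<in>V. \<Sum>r\<in>UNIV. vertex_coeff v r * B_vertex v r x) +
      (\<lambda>x. \<Sum>\<eta>\<in>Xi1. edge_coeff \<eta> * B1 \<eta> x) \<in> S2"
    using second_reduction_in_S2 unfolding S2_def by (intro real_fun.span_add) auto
  then show ?thesis
    unfolding plus_fun_def spline_first_reduction[symmetric] spline_blossom .
qed

end

text \<open>Functions are total and splines vanish off the triangulated region, which is the closure
  of the domain; hence the polynomial is cut off to zero outside it.\<close>

theorem mainTheorem3:
  fixes \<Omega> :: "point set" and \<Delta> Tl :: "point set set" and l :: nat
    and vt ve :: "point set \<Rightarrow> point" and q :: "point \<Rightarrow> 3 \<Rightarrow> point"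
    and p :: "point \<Rightarrow> real"
  assumes "open \<Omega>" and "connected \<Omega>" and "\<Omega> \<noteq> {}" and "bounded \<Omega>"
    and "triangulation_of \<Omega> \<Delta>"
    and "l \<ge> 1"
    and "Tl = uniform_refinement l \<Delta>"
    and "cubic_ps.powell_sabin_points Tl vt ve"
    and "cubic_ps.control_triangles Tl vt ve q"
    and "p \<in> polynomials_of_degree_le 3"
  shows "(\<lambda>x. if x \<in> closure \<Omega> then p x else 0) \<in> cubic_ps.S2 Tl vt ve q"
proof -
  obtain P where P: "blossom P" "\<And>x. P x x x = p x"
    using cubic_has_blossom[OF assms(10)] by metis
  have \<Delta>: "finite \<Delta>" "\<forall>t\<in>\<Delta>. card t = 3" "covered \<Delta> = closure \<Omega>"
    using assms(5) unfolding triangulation_of_def by auto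
  interpret powell_sabin_blossom Tl vt ve q P
  proof
    show "finite Tl"
      unfolding assms(7) using \<Delta> by (intro finite_uniform_refinement)
    show "finite t \<and> card t \<le> 3" if "t \<in> Tl" for t
      using that card_uniform_split_le unfolding assms(7) uniform_refinement_def by blast
  qed (fact assms P)+
  have "covered Tl = closure \<Omega>"
    unfolding assms(7) using covered_uniform_refinement assms(6) \<Delta> by simp
  then show ?thesis using blossom_diagonal_in_S2 by (simp add: P(2) cong: if_cong)
qed

end
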